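(* Setting: $n$ agents on a connected, undirected weighted graph $\mathcal G$ with symmetric adjacency weights $a_{i,j}$ ($a_{i,j}>0$ iff $\{i,j\}$ is an edge, else $0$) and Laplacian $L_n$; $L=L_n\otimes I_m$. For each $i$, $\Omega_i\subset\mathbb R^{q_i}$ is closed and convex, $f^i$ is strictly convex on an open set containing $\Omega_i$, $W_i\in\mathbb R^{m\times q_i}$, $d_i\in\mathbb R^m$ with $\sum_id_i=d_0$; $\Omega=\prod_i\Omega_i$, $f(x)=\sum_if^i(x_i)$, $W=[W_1,\dots,W_n]$, $\overline W=\mathrm{diag}\{W_1,\dots,W_n\}$, $d=[d_1^{\rm T},\dots,d_n^{\rm T}]^{\rm T}$; Slater's condition holds (some $x$ in the interior of $\Omega$ has $Wx=d_0$). Consider the problem $\min f(x)$ s.t. $Wx=d_0$, $x\in\Omega$, and the algorithm (for $t\ge0$, $x_i(0)\in\Omega_i$, $\lambda_i(0),z_i(0)\in\mathbb R^m$ arbitrary) $$\dot x_i\in\{P_{\Omega_i}[x_i-g_i+W_i^{\rm T}\lambda_i]-x_i:\ g_i\in\partial f^i(x_i)\},$$ $$\dot\lambda_i=d_i-W_ix_i-\sum_ja_{i,j}(\lambda_i-\lambda_j)-\sum_ja_{i,j}(z_i-z_j)-W_i\dot x_i,\qquad \dot z_i=\sum_ja_{i,j}(\lambda_i-\lambda_j),$$ equivalently $(\dot x,\dot\lambda,\dot z)\in\mathcal F(x,\lambda,z)=\{(p,\ d-\overline Wx-L\lambda-Lz-\overline Wp,\ L\lambda):\ p=P_\Omega[x-g+\overline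 W^{\rm T}\lambda]-x,\ g\in\partial f(x)\}$. Assume $\mathcal F(x,\lambda,z)$ is a convex set for every $(x,\lambda,z)\in\Omega\times\mathbb R^{nm}\times\mathbb R^{nm}$. Then (i) every solution $(x(t),\lambda(t),z(t))$ is bounded; (ii) for every solution, $x(t)$ converges to the optimal solution of the problem as $t\to\infty$.
   Context: $\partial f$ is the convex subdifferential; $P_\Omega$ the Euclidean projection onto $\Omega$. A solution is an absolutely continuous function on $[0,\infty)$ satisfying the inclusion for almost all $t$ (solutions are assumed to exist on $[0,\infty)$).
   Formalization: It is additionally assumed that the problem has an optimal solution; without this (i) fails, e.g. for one agent with Ω=ℝ, f=exp, W=0, d=0, where x(t)=−ln(1+t) is an unbounded solution. *)

theory Defs
  imports "HOL-Analysis.Analysis"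
begin

text \<open>Vectors of R^q are represented as functions nat => real vanishing from index q on.
  Agents are indexed by i < n; a global vector (x_1,...,x_n) is a function nat => nat => real.\<close>

definition Rn :: "nat \<Rightarrow> (nat \<Rightarrow> real) set" where
  "Rn q = {v. \<forall>k\<ge>q. v k = 0}"

definition ip :: "nat \<Rightarrow> (nat \<Rightarrow> real) \<Rightarrow> (nat \<Rightarrow> real) \<Rightarrow> real" where
  "ip q u v = (\<Sum>k<q. u k * v k)"

definition nrm :: "nat \<Rightarrow> (nat \<Rightarrow> real) \<Rightarrow> real" where
  "nrm q v = sqrt (ip q v v)"

definition comb :: "real \<Rightarrow> (nat \<Rightarrow> real) \<Rightarrow> (nat \<Rightarrow> real) \<Rightarrow> (nat \<Rightarrow> real)" where
  "comb \<theta> u v = (\<lambda>k. (1 - \<theta>) * u k + \<theta> * v k)"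

definition cvx_set :: "(nat \<Rightarrow> real) set \<Rightarrow> bool" where
  "cvx_set S = (\<forall>u\<in>S. \<forall>v\<in>S. \<forall>\<theta>::real. 0 \<le> \<theta> \<and> \<theta> \<le> 1 \<longrightarrow> comb \<theta> u v \<in> S)"

definition open_Rn :: "nat \<Rightarrow> (nat \<Rightarrow> real) set \<Rightarrow> bool" where
  "open_Rn q U = (U \<subseteq> Rn q \<and>
     (\<forall>u\<in>U. \<exists>e>0. \<forall>v\<in>Rn q. nrm q (\<lambda>k. v k - u k) < e \<longrightarrow> v \<in> U))"

definition closed_Rn :: "nat \<Rightarrow> (nat \<Rightarrow> real) set \<Rightarrow> bool" where
  "closed_Rn q S = (S \<subseteq> Rn q \<and> open_Rn q (Rn q - S))"

definition interior_Rn :: "nat \<Rightarrow> (nat \<Rightarrow> real) set \<Rightarrow> (nat \<Rightarrow> real) set" where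
  "interior_Rn q S = {u \<in> S. \<exists>e>0. \<forall>v\<in>Rn q. nrm q (\<lambda>k. v k - u k) < e \<longrightarrow> v \<in> S}"

text \<open>Strict convexity (same shape as the library's strict_convex_on).\<close>
definition strict_cvx_on :: "nat \<Rightarrow> (nat \<Rightarrow> real) set \<Rightarrow> ((nat \<Rightarrow> real) \<Rightarrow> real) \<Rightarrow> bool" where
  "strict_cvx_on q U h = (\<forall>u\<in>U. \<forall>v\<in>U. u \<noteq> v \<longrightarrow>
     (\<forall>\<theta>::real. 0 < \<theta> \<and> \<theta> < 1 \<longrightarrow> h (comb \<theta> u v) < (1 - \<theta>) * h u + \<theta> * h v))"

text \<open>Convex subdifferential of h (defined on the open domain U) at x.\<close>
definition subgrad :: "nat \<Rightarrow> (nat \<Rightarrow> real) set \<Rightarrow> ((nat \<Rightarrow> real) \<Rightarrow> real) \<Rightarrow> (nat \<Rightarrow> real) \<Rightarrow> (nat \<Rightarrow> real) set" where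
  "subgrad q U h x = {g \<in> Rn q. \<forall>y\<in>U. h y \<ge> h x + ip q g (\<lambda>k. y k - x k)}"

text \<open>Euclidean projection onto S (a closed convex nonempty subset of R^q).\<close>
definition proj :: "nat \<Rightarrow> (nat \<Rightarrow> real) set \<Rightarrow> (nat \<Rightarrow> real) \<Rightarrow> (nat \<Rightarrow> real)" where
  "proj q S y = (THE p. p \<in> S \<and> (\<forall>w\<in>S. nrm q (\<lambda>k. y k - p k) \<le> nrm q (\<lambda>k. y k - w k)))"

text \<open>W i r k: entry (r,k) of the m x q_i matrix W_i.\<close>
definition Wmul :: "nat \<Rightarrow> nat \<Rightarrow> (nat \<Rightarrow> nat \<Rightarrow> real) \<Rightarrow> (nat \<Rightarrow> real) \<Rightarrow> (nat \<Rightarrow> real)" where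
  "Wmul m qi Wi v = (\<lambda>r. if r < m then (\<Sum>k<qi. Wi r k * v k) else 0)"

definition WTmul :: "nat \<Rightarrow> nat \<Rightarrow> (nat \<Rightarrow> nat \<Rightarrow> real) \<Rightarrow> (nat \<Rightarrow> real) \<Rightarrow> (nat \<Rightarrow> real)" where
  "WTmul m qi Wi l = (\<lambda>k. if k < qi then (\<Sum>r<m. Wi r k * l r) else 0)"

text \<open>Laplacian action: (L y)_i = sum_j a_ij (y_i - y_j), restricted to the first m coordinates.\<close>
definition lap :: "nat \<Rightarrow> nat \<Rightarrow> (nat \<Rightarrow> nat \<Rightarrow> real) \<Rightarrow> (nat \<Rightarrow> nat \<Rightarrow> real) \<Rightarrow> nat \<Rightarrow> (nat \<Rightarrow> real)" where
  "lap n m a y i = (\<lambda>r. if r < m then (\<Sum>j<n. a i j * (y i r - y j r)) else 0)"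

text \<open>Undirected weighted graph on {0..<n}: symmetric nonnegative weights, no self loops, connected.\<close>
definition weighted_graph :: "nat \<Rightarrow> (nat \<Rightarrow> nat \<Rightarrow> real) \<Rightarrow> bool" where
  "weighted_graph n a = (\<forall>i<n. \<forall>j<n. a i j = a j i \<and> a i j \<ge> 0 \<and> a i i = 0)"

definition graph_connected :: "nat \<Rightarrow> (nat \<Rightarrow> nat \<Rightarrow> real) \<Rightarrow> bool" where
  "graph_connected n a = (\<forall>i<n. \<forall>j<n. (i, j) \<in> {(u, v). u < n \<and> v < n \<and> a u v > 0}\<^sup>*)"

text \<open>Canonical representations of Omega, of R^{q_1} x ... x R^{q_n}, and of R^{nm}.\<close>
definition Xset :: "nat \<Rightarrow> (nat \<Rightarrow> (nat \<Rightarrow> real) set) \<Rightarrow> (nat \<Rightarrow> nat \<Rightarrow> real) set" where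
  "Xset n Om = {x. (\<forall>i<n. x i \<in> Om i) \<and> (\<forall>i\<ge>n. x i = (\<lambda>_. 0))}"

definition Xspace :: "nat \<Rightarrow> (nat \<Rightarrow> nat) \<Rightarrow> (nat \<Rightarrow> nat \<Rightarrow> real) set" where
  "Xspace n q = Xset n (\<lambda>i. Rn (q i))"

definition Lspace :: "nat \<Rightarrow> nat \<Rightarrow> (nat \<Rightarrow> nat \<Rightarrow> real) set" where
  "Lspace n m = Xset n (\<lambda>_. Rn m)"

text \<open>The set-valued map F(x, lambda, z).\<close>
definition Fmap :: "nat \<Rightarrow> nat \<Rightarrow> (nat \<Rightarrow> nat) \<Rightarrow> (nat \<Rightarrow> nat \<Rightarrow> real)
    \<Rightarrow> (nat \<Rightarrow> (nat \<Rightarrow> real) set) \<Rightarrow> (nat \<Rightarrow> (nat \<Rightarrow> real) set) \<Rightarrow> (nat \<Rightarrow> (nat \<Rightarrow> real) \<Rightarrow> real)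
    \<Rightarrow> (nat \<Rightarrow> nat \<Rightarrow> nat \<Rightarrow> real) \<Rightarrow> (nat \<Rightarrow> nat \<Rightarrow> real)
    \<Rightarrow> (nat \<Rightarrow> nat \<Rightarrow> real) \<Rightarrow> (nat \<Rightarrow> nat \<Rightarrow> real) \<Rightarrow> (nat \<Rightarrow> nat \<Rightarrow> real)
    \<Rightarrow> ((nat \<Rightarrow> nat \<Rightarrow> real) \<times> (nat \<Rightarrow> nat \<Rightarrow> real) \<times> (nat \<Rightarrow> nat \<Rightarrow> real)) set" where
  "Fmap n m q a Om U f W d x l z =
     {(p, u, w) | p u w. \<exists>g. (\<forall>i<n. g i \<in> subgrad (q i) (U i) (f i) (x i)) \<and>
        p = (\<lambda>i. if i < n then (\<lambda>k. if k < q i then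
               proj (q i) (Om i) (\<lambda>k'. x i k' - g i k' + WTmul m (q i) (W i) (l i) k') k - x i k
             else 0) else (\<lambda>_. 0)) \<and>
        u = (\<lambda>i. if i < n then (\<lambda>r. if r < m then
               d i r - Wmul m (q i) (W i) (x i) r - lap n m a l i r - lap n m a z i r
               - Wmul m (q i) (W i) (p i) r
             else 0) else (\<lambda>_. 0)) \<and>
        w = (\<lambda>i. if i < n then lap n m a l i else (\<lambda>_. 0))}"

definition comb2 :: "real \<Rightarrow> (nat \<Rightarrow> nat \<Rightarrow> real) \<Rightarrow> (nat \<Rightarrow> nat \<Rightarrow> real) \<Rightarrow> (nat \<Rightarrow> nat \<Rightarrow> real)" where
  "comb2 \<theta> u v = (\<lambda>i k. (1 - \<theta>) * u i k + \<theta> * v i k)"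

definition cvx_set3 :: "((nat \<Rightarrow> nat \<Rightarrow> real) \<times> (nat \<Rightarrow> nat \<Rightarrow> real) \<times> (nat \<Rightarrow> nat \<Rightarrow> real)) set \<Rightarrow> bool" where
  "cvx_set3 S = (\<forall>p1 u1 w1 p2 u2 w2. (p1, u1, w1) \<in> S \<longrightarrow> (p2, u2, w2) \<in> S \<longrightarrow>
      (\<forall>\<theta>::real. 0 \<le> \<theta> \<and> \<theta> \<le> 1 \<longrightarrow> (comb2 \<theta> p1 p2, comb2 \<theta> u1 u2, comb2 \<theta> w1 w2) \<in> S))"

text \<open>Absolute continuity of a real function on a set S (finite families of nonoverlapping intervals).\<close>
definition abs_cont_on :: "real set \<Rightarrow> (real \<Rightarrow> real) \<Rightarrow> bool" where
  "abs_cont_on S h = (\<forall>e>0. \<exists>\<delta>>0. \<forall>(N::nat) (\<alpha>::nat \<Rightarrow> real) \<beta>.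
      (\<forall>k<N. \<alpha> k \<le> \<beta> k \<and> {\<alpha> k..\<beta> k} \<subseteq> S) \<and>
      (\<forall>k<N. \<forall>k'<N. k \<noteq> k' \<longrightarrow> \<beta> k \<le> \<alpha> k' \<or> \<beta> k' \<le> \<alpha> k) \<and>
      (\<Sum>k<N. \<beta> k - \<alpha> k) < \<delta> \<longrightarrow> (\<Sum>k<N. \<bar>h (\<beta> k) - h (\<alpha> k)\<bar>) < e)"

text \<open>Solution of the inclusion (dx, dl, dz) \<in> F(x, l, z) on [0, \<infinity>): absolutely continuous
  (on every compact [0,T]) and satisfying the inclusion for almost all t.\<close>
definition is_solution :: "nat \<Rightarrow> nat \<Rightarrow> (nat \<Rightarrow> nat) \<Rightarrow> (nat \<Rightarrow> nat \<Rightarrow> real)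
    \<Rightarrow> (nat \<Rightarrow> (nat \<Rightarrow> real) set) \<Rightarrow> (nat \<Rightarrow> (nat \<Rightarrow> real) set) \<Rightarrow> (nat \<Rightarrow> (nat \<Rightarrow> real) \<Rightarrow> real)
    \<Rightarrow> (nat \<Rightarrow> nat \<Rightarrow> nat \<Rightarrow> real) \<Rightarrow> (nat \<Rightarrow> nat \<Rightarrow> real)
    \<Rightarrow> (real \<Rightarrow> nat \<Rightarrow> nat \<Rightarrow> real) \<Rightarrow> (real \<Rightarrow> nat \<Rightarrow> nat \<Rightarrow> real) \<Rightarrow> (real \<Rightarrow> nat \<Rightarrow> nat \<Rightarrow> real) \<Rightarrow> bool" where
  "is_solution n m q a Om U f W d x l z =
     ((\<forall>t\<ge>0. x t \<in> Xspace n q \<and> l t \<in> Lspace n m \<and> z t \<in> Lspace n m) \<and>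
      (\<forall>T\<ge>0. \<forall>i<n. (\<forall>k<q i. abs_cont_on {0..T} (\<lambda>t. x t i k)) \<and>
                   (\<forall>r<m. abs_cont_on {0..T} (\<lambda>t. l t i r) \<and> abs_cont_on {0..T} (\<lambda>t. z t i r))) \<and>
      (AE t in lebesgue. t > 0 \<longrightarrow>
         (\<exists>p u w. (p, u, w) \<in> Fmap n m q a Om U f W d (x t) (l t) (z t) \<and>
            (\<forall>i<n. (\<forall>k<q i. ((\<lambda>s. x s i k) has_real_derivative p i k) (at t)) \<and>
                   (\<forall>r<m. ((\<lambda>s. l s i r) has_real_derivative u i r) (at t) \<and>
                          ((\<lambda>s. z s i r) has_real_derivative w i r) (at t))))))"

text \<open>Optimal solution of  min sum_i f_i(x_i)  s.t.  sum_i W_i x_i = sum_i d_i,  x in Omega.\<close>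
definition feasible :: "nat \<Rightarrow> nat \<Rightarrow> (nat \<Rightarrow> nat) \<Rightarrow> (nat \<Rightarrow> (nat \<Rightarrow> real) set)
    \<Rightarrow> (nat \<Rightarrow> nat \<Rightarrow> nat \<Rightarrow> real) \<Rightarrow> (nat \<Rightarrow> nat \<Rightarrow> real) \<Rightarrow> (nat \<Rightarrow> nat \<Rightarrow> real) \<Rightarrow> bool" where
  "feasible n m q Om W d x = (x \<in> Xset n Om \<and>
     (\<forall>r<m. (\<Sum>i<n. Wmul m (q i) (W i) (x i) r) = (\<Sum>i<n. d i r)))"

definition is_optimal :: "nat \<Rightarrow> nat \<Rightarrow> (nat \<Rightarrow> nat) \<Rightarrow> (nat \<Rightarrow> (nat \<Rightarrow> real) set)
    \<Rightarrow> (nat \<Rightarrow> (nat \<Rightarrow> real) \<Rightarrow> real) \<Rightarrow> (nat \<Rightarrow> nat \<Rightarrow> nat \<Rightarrow> real) \<Rightarrow> (nat \<Rightarrow> nat \<Rightarrow> real)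
    \<Rightarrow> (nat \<Rightarrow> nat \<Rightarrow> real) \<Rightarrow> bool" where
  "is_optimal n m q Om f W d xs = (feasible n m q Om W d xs \<and>
     (\<forall>y. feasible n m q Om W d y \<longrightarrow> (\<Sum>i<n. f i (xs i)) \<le> (\<Sum>i<n. f i (y i))))"

end

theory Submission
  imports Defs
begin

text \<open>
  Slater's condition gives a multiplier \<open>\<mu>\<close> for the coupling constraint, so the Lagrangian gap
  \<open>gap y = f y - f x\<^sup>* - \<mu> \<cdot> (W y - d\<^sub>0)\<close> is nonnegative on \<open>\<Omega>\<close>, and by strict convexity it vanishes
  only at the optimum \<open>x\<^sup>*\<close>.  Connectedness gives \<open>z\<^sup>*\<close> whose Laplacian image is the vector of
  local residuals \<open>d\<^sub>i - W\<^sub>i x\<^sup>*\<^sub>i\<close>.  Combining the variational inequality of the projection at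
  \<open>x\<^sup>*\<close> with the subgradient inequality, the function
  \<open>V = gap x + (|x - x\<^sup>*|\<^sup>2 + |\<lambda> - \<mu>|\<^sup>2 + |z - z\<^sup>*|\<^sup>2) / 2\<close> satisfies
  \<open>V' \<le> - |x'|\<^sup>2 - gap x\<close> along solutions, which bounds them.  Since \<open>\<plusminus> v \<le> v\<^sup>2 + 1/4\<close>,
  the first term also controls the increments of \<open>x\<close> by the decrease of \<open>V\<close>; hence \<open>x\<close> cannot return infinitely often to
  a distance \<open>\<epsilon>\<close> from \<open>x\<^sup>*\<close> without the gap term consuming a fixed amount of \<open>V\<close> each time.

  The function \<open>f \<circ> x\<close> need not be known to be differentiable: a subgradient at time \<open>t\<close> bounds the
  differences \<open>f (x t) - f (x s)\<close> from above, and for absolutely continuous functions such a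
  bound on left difference quotients at almost every time is enough for monotonicity.
\<close>

section \<open>Absolutely continuous functions\<close>

definition interval_family :: "real set \<Rightarrow> nat \<Rightarrow> (nat \<Rightarrow> real) \<Rightarrow> (nat \<Rightarrow> real) \<Rightarrow> bool" where
  "interval_family S N \<alpha> \<beta> \<longleftrightarrow> (\<forall>k<N. \<alpha> k \<le> \<beta> k \<and> {\<alpha> k..\<beta> k} \<subseteq> S) \<and>
     (\<forall>k<N. \<forall>k'<N. k \<noteq> k' \<longrightarrow> \<beta> k \<le> \<alpha> k' \<or> \<beta> k' \<le> \<alpha> k)"

definition small_variation :: "real set \<Rightarrow> (real \<Rightarrow> real) \<Rightarrow> real \<Rightarrow> real \<Rightarrow> bool" where
  "small_variation S h \<delta> e \<longleftrightarrow> (\<forall>N \<alpha> \<beta>. interval_family S N \<alpha> \<beta> \<and> (\<Sum>k<N. \<beta> k - \<alpha> k) < \<delta> \<longrightarrow>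
     (\<Sum>k<N. \<bar>h (\<beta> k) - h (\<alpha> k)\<bar>) < e)"

lemma abs_cont_on_iff: "abs_cont_on S h \<longleftrightarrow> (\<forall>e>0. \<exists>\<delta>>0. small_variation S h \<delta> e)"
  unfolding abs_cont_on_def small_variation_def interval_family_def by (simp add: conj_assoc)

lemma interval_family_subset: "interval_family S N \<alpha> \<beta> \<Longrightarrow> S \<subseteq> T \<Longrightarrow> interval_family T N \<alpha> \<beta>"
  unfolding interval_family_def by blast

lemma interval_family_endpoints:
  assumes "interval_family S N \<alpha> \<beta>" "k < N"
  shows "\<alpha> k \<le> \<beta> k" "\<alpha> k \<in> S" "\<beta> k \<in> S"
proof -
  show "\<alpha> k \<le> \<beta> k" using assms by (simp add: interval_family_def)
  moreover have "{\<alpha> k..\<beta> k} \<subseteq> S" using assms by (simp add: interval_family_def)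
  ultimately show "\<alpha> k \<in> S" "\<beta> k \<in> S" by auto
qed

lemma interval_family_nonoverlapping:
  "interval_family S N \<alpha> \<beta> \<Longrightarrow> k < N \<Longrightarrow> k' < N \<Longrightarrow> k \<noteq> k' \<Longrightarrow> \<beta> k \<le> \<alpha> k' \<or> \<beta> k' \<le> \<alpha> k"
  by (simp add: interval_family_def)

lemma interval_family_mono_image:
  assumes family: "interval_family S N \<alpha> \<beta>" and "mono \<phi>" and "\<phi> ` S \<subseteq> {c..d}"
  shows "interval_family {c..d} N (\<lambda>k. \<phi> (\<alpha> k)) (\<lambda>k. \<phi> (\<beta> k))"
  unfolding interval_family_def
proof (intro conjI allI impI)
  fix k assume k: "k < N"
  show "\<phi> (\<alpha> k) \<le> \<phi> (\<beta> k)"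
    using interval_family_endpoints(1)[OF family k] by (rule monoD[OF \<open>mono \<phi>\<close>])
  show "{\<phi> (\<alpha> k)..\<phi> (\<beta> k)} \<subseteq> {c..d}"
    using interval_family_endpoints(2,3)[OF family k] assms(3) by fastforce
next
  fix k k' assume "k < N" "k' < N" "k \<noteq> k'"
  then have "\<beta> k \<le> \<alpha> k' \<or> \<beta> k' \<le> \<alpha> k" by (rule interval_family_nonoverlapping[OF family])
  then show "\<phi> (\<beta> k) \<le> \<phi> (\<alpha> k') \<or> \<phi> (\<beta> k') \<le> \<phi> (\<alpha> k)"
    using monoD[OF \<open>mono \<phi>\<close>] by blast
qed

lemma abs_cont_on_subset: "abs_cont_on S h \<Longrightarrow> T \<subseteq> S \<Longrightarrow> abs_cont_on T h"
  unfolding abs_cont_on_iff small_variation_def by (meson interval_family_subset)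

lemma abs_cont_on_imp_continuous_on:
  assumes "abs_cont_on {a..b} h"
  shows "continuous_on {a..b} h"
  unfolding continuous_on_iff
proof (intro ballI allI impI)
  fix x e :: real assume x: "x \<in> {a..b}" and "e > 0"
  then obtain \<delta> where "\<delta> > 0" and \<delta>: "small_variation {a..b} h \<delta> e"
    using assms by (auto simp: abs_cont_on_iff)
  have "dist (h y) (h x) < e" if y: "y \<in> {a..b}" "dist y x < \<delta>" for y
  proof -
    have "interval_family {a..b} 1 (\<lambda>_. min x y) (\<lambda>_. max x y)"
      using x y by (auto simp: interval_family_def)
    then show ?thesis
      using \<delta>[unfolded small_variation_def, rule_format, of 1 "\<lambda>_. min x y" "\<lambda>_. max x y"] y(2)
      by (cases "x \<le> y") (auto simp: dist_real_def abs_minus_commute)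
  qed
  then show "\<exists>d>0. \<forall>x'\<in>{a..b}. dist x' x < d \<longrightarrow> dist (h x') (h x) < e"
    using \<open>\<delta> > 0\<close> by blast
qed

lemma small_variation_antimono: "small_variation S h \<delta> e \<Longrightarrow> \<delta>' \<le> \<delta> \<Longrightarrow> small_variation S h \<delta>' e"
  unfolding small_variation_def by (meson less_le_trans)

lemma small_variation_dominated:
  fixes y :: "'j \<Rightarrow> real \<Rightarrow> real"
  assumes "M > 0" "e > 0" and small: "\<And>j. j \<in> I \<Longrightarrow> small_variation S (y j) \<delta> e"
    and dominated: "\<And>s t. s \<in> S \<Longrightarrow> t \<in> S \<Longrightarrow> \<bar>h s - h t\<bar> \<le> M * (\<Sum>j\<in>I. \<bar>y j s - y j t\<bar>)"
  shows "small_variation S h \<delta> (M * ((real (card I) + 1) * e))"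
  unfolding small_variation_def
proof (intro allI impI, elim conjE)
  fix N \<alpha> \<beta> assume family: "interval_family S N \<alpha> \<beta>" and short: "(\<Sum>k<N. \<beta> k - \<alpha> k) < \<delta>"
  have each: "(\<Sum>k<N. \<bar>y j (\<beta> k) - y j (\<alpha> k)\<bar>) \<le> e" if "j \<in> I" for j
    using small[OF that] family short unfolding small_variation_def by (blast intro: less_imp_le)
  have "(\<Sum>k<N. \<bar>h (\<beta> k) - h (\<alpha> k)\<bar>) \<le> (\<Sum>k<N. M * (\<Sum>j\<in>I. \<bar>y j (\<beta> k) - y j (\<alpha> k)\<bar>))"
    using interval_family_endpoints[OF family] by (intro sum_mono dominated) auto
  also have "\<dots> = M * (\<Sum>j\<in>I. \<Sum>k<N. \<bar>y j (\<beta> k) - y j (\<alpha> k)\<bar>)"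
    by (subst sum.swap) (simp add: sum_distrib_left)
  also have "\<dots> \<le> M * (\<Sum>j\<in>I. e)"
    using each \<open>M > 0\<close> by (intro mult_left_mono sum_mono) auto
  also have "\<dots> < M * ((real (card I) + 1) * e)"
    using \<open>M > 0\<close> \<open>e > 0\<close> by (intro mult_strict_left_mono) (auto simp: algebra_simps)
  finally show "(\<Sum>k<N. \<bar>h (\<beta> k) - h (\<alpha> k)\<bar>) < M * ((real (card I) + 1) * e)" .
qed

lemma abs_cont_on_dominated:
  fixes y :: "'j \<Rightarrow> real \<Rightarrow> real"
  assumes finite: "finite I" and abs_cont: "\<And>j. j \<in> I \<Longrightarrow> abs_cont_on S (y j)"
    and dominated: "\<And>s t. s \<in> S \<Longrightarrow> t \<in> S \<Longrightarrow> \<bar>h s - h t\<bar> \<le> M * (\<Sum>j\<in>I. \<bar>y j s - y j t\<bar>)"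
  shows "abs_cont_on S h"
  unfolding abs_cont_on_iff
proof (intro allI impI)
  fix e :: real assume "e > 0"
  define M' where "M' = \<bar>M\<bar> + 1"
  define e' where "e' = e / (M' * (real (card I) + 1))"
  have M': "M' > 0" "M \<le> M'" by (auto simp: M'_def)
  have e': "e' > 0" "M' * ((real (card I) + 1) * e') = e"
    using \<open>e > 0\<close> M' by (simp_all add: e'_def)
  have "\<forall>j\<in>I. \<exists>\<delta>>0. small_variation S (y j) \<delta> e'"
    using abs_cont e'(1) by (simp add: abs_cont_on_iff)
  then obtain D where D: "\<forall>j\<in>I. D j > 0 \<and> small_variation S (y j) (D j) e'"
    by (rule bchoice[THEN exE])
  define \<delta> where "\<delta> = Min (insert 1 (D ` I))"
  have "\<delta> > 0" and \<delta>_le: "\<And>j. j \<in> I \<Longrightarrow> \<delta> \<le> D j" using finite D by (auto simp: \<delta>_def)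
  have "small_variation S (y j) \<delta> e'" if "j \<in> I" for j
    using D \<delta>_le that small_variation_antimono by blast
  moreover have "\<bar>h s - h t\<bar> \<le> M' * (\<Sum>j\<in>I. \<bar>y j s - y j t\<bar>)" if "s \<in> S" "t \<in> S" for s t
    using dominated[OF that] mult_right_mono[OF M'(2), of "\<Sum>j\<in>I. \<bar>y j s - y j t\<bar>"]
    by (simp add: sum_nonneg)
  ultimately have "small_variation S h \<delta> e"
    using small_variation_dominated[of M' e' I S y \<delta> h] M'(1) e' by simp
  then show "\<exists>\<delta>>0. small_variation S h \<delta> e" using \<open>\<delta> > 0\<close> by blast
qed

lemma abs_cont_on_sum:
  assumes "finite I" "\<And>j. j \<in> I \<Longrightarrow> abs_cont_on S (y j)"
  shows "abs_cont_on S (\<lambda>t. \<Sum>j\<in>I. y j t)"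
proof (rule abs_cont_on_dominated[OF assms, where M = 1])
  fix s t
  show "\<bar>(\<Sum>j\<in>I. y j s) - (\<Sum>j\<in>I. y j t)\<bar> \<le> 1 * (\<Sum>j\<in>I. \<bar>y j s - y j t\<bar>)"
    by (simp add: sum_subtractf[symmetric] sum_abs)
qed auto

lemma abs_cont_on_add:
  assumes "abs_cont_on S h" "abs_cont_on S k"
  shows "abs_cont_on S (\<lambda>t. h t + k t)"
proof -
  have "abs_cont_on S (\<lambda>t. \<Sum>b\<in>UNIV. (if b then h else k) t)"
    by (rule abs_cont_on_sum) (use assms in auto)
  then show ?thesis by (simp add: UNIV_bool add.commute)
qed

lemma abs_cont_on_ident: "abs_cont_on S (\<lambda>t. t)"
  unfolding abs_cont_on_iff
proof (intro allI impI exI conjI)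
  fix e :: real
  show "small_variation S (\<lambda>t. t) e e"
    by (auto simp: small_variation_def interval_family_def)
qed

lemma abs_cont_on_lipschitz:
  assumes "M-lipschitz_on S h"
  shows "abs_cont_on S h"
proof (rule abs_cont_on_dominated[where I = "{()}" and y = "\<lambda>_ t. t" and M = M])
  show "\<bar>h s - h t\<bar> \<le> M * (\<Sum>j\<in>{()}. \<bar>s - t\<bar>)" if "s \<in> S" "t \<in> S" for s t
    using lipschitz_onD[OF assms that] by (simp add: dist_real_def)
qed (auto intro: abs_cont_on_ident)

lemma abs_cont_on_const: "abs_cont_on S (\<lambda>t. c)"
  by (rule abs_cont_on_lipschitz) (rule lipschitz_on_constant)

lemma abs_cont_on_exp: "abs_cont_on {a..b} (exp :: real \<Rightarrow> real)"
proof (rule abs_cont_on_lipschitz)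
  show "(exp b)-lipschitz_on {a..b} (exp :: real \<Rightarrow> real)"
  proof (rule bounded_derivative_imp_lipschitz)
    show "(exp has_derivative (*) (exp x)) (at x within {a..b})" for x :: real
      using DERIV_subset[OF DERIV_exp] by (auto simp: has_field_derivative_def)
    show "onorm ((*) (exp x)) \<le> exp b" if "x \<in> {a..b}" for x :: real
      using that by (intro onorm_le) (auto intro!: mult_right_mono simp: abs_mult)
  qed auto
qed

lemma abs_cont_on_mult:
  assumes "abs_cont_on {a..b} h" "abs_cont_on {a..b} k"
  shows "abs_cont_on {a..b} (\<lambda>t. h t * k t)"
proof -
  have bound: "\<exists>B\<ge>0. \<forall>t\<in>{a..b}. \<bar>h t\<bar> \<le> B" if "abs_cont_on {a..b} h" for h
  proof -
    have "bounded (h ` {a..b})"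
      by (intro compact_imp_bounded compact_continuous_image abs_cont_on_imp_continuous_on that) auto
    then show ?thesis unfolding bounded_pos by (auto intro: less_imp_le)
  qed
  obtain A where A: "A \<ge> 0" "\<forall>t\<in>{a..b}. \<bar>h t\<bar> \<le> A" using bound[OF assms(1)] by blast
  obtain B where B: "B \<ge> 0" "\<forall>t\<in>{a..b}. \<bar>k t\<bar> \<le> B" using bound[OF assms(2)] by blast
  show ?thesis
  proof (rule abs_cont_on_dominated[where I = UNIV and y = "\<lambda>b. if b then h else k" and M = "A + B"])
    fix s t assume st: "s \<in> {a..b}" "t \<in> {a..b}"
    have "h s * k s - h t * k t = (h s - h t) * k s + h t * (k s - k t)"
      by (simp add: algebra_simps)
    then have "\<bar>h s * k s - h t * k t\<bar> \<le> \<bar>h s - h t\<bar> * \<bar>k s\<bar> + \<bar>h t\<bar> * \<bar>k s - k t\<bar>"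
      using abs_triangle_ineq[of "(h s - h t) * k s" "h t * (k s - k t)"] by (simp add: abs_mult)
    also have "\<dots> \<le> \<bar>h s - h t\<bar> * (A + B) + (A + B) * \<bar>k s - k t\<bar>"
      using A B st by (intro add_mono mult_left_mono mult_right_mono)
        (auto intro: add_increasing add_increasing2)
    finally show "\<bar>h s * k s - h t * k t\<bar> \<le>
        (A + B) * (\<Sum>j\<in>UNIV. \<bar>(if j then h else k) s - (if j then h else k) t\<bar>)"
      by (simp add: UNIV_bool algebra_simps)
  qed (use assms in auto)
qed

lemma abs_cont_on_cmult: "abs_cont_on {a..b} h \<Longrightarrow> abs_cont_on {a..b} (\<lambda>t. c * h t)"
  by (intro abs_cont_on_mult abs_cont_on_const)

lemma abs_cont_on_diff:
  assumes "abs_cont_on {a..b} h" "abs_cont_on {a..b} k"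
  shows "abs_cont_on {a..b} (\<lambda>t. h t - k t)"
  using abs_cont_on_add[OF assms(1) abs_cont_on_cmult[OF assms(2), of "-1"]] by simp

text \<open>Clamping the endpoints at \<open>b\<close> splits a family of intervals in \<open>{a..c}\<close> into one on each
  side of \<open>b\<close>.\<close>

lemma abs_cont_on_concat:
  assumes "a \<le> b" "b \<le> c" and abs_cont: "abs_cont_on {a..b} h" "abs_cont_on {b..c} h"
  shows "abs_cont_on {a..c} h"
  unfolding abs_cont_on_iff
proof (intro allI impI)
  fix e :: real assume "e > 0"
  then obtain \<delta>1 \<delta>2 where \<delta>: "\<delta>1 > 0" "small_variation {a..b} h \<delta>1 (e / 2)"
      "\<delta>2 > 0" "small_variation {b..c} h \<delta>2 (e / 2)"
    using abs_cont unfolding abs_cont_on_iff by (meson half_gt_zero)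
  have "small_variation {a..c} h (min \<delta>1 \<delta>2) e"
    unfolding small_variation_def
  proof (intro allI impI, elim conjE)
    fix N \<alpha> \<beta> assume family: "interval_family {a..c} N \<alpha> \<beta>" and short: "(\<Sum>k<N. \<beta> k - \<alpha> k) < min \<delta>1 \<delta>2"
    have clamped: "interval_family {a..b} N (\<lambda>k. min (\<alpha> k) b) (\<lambda>k. min (\<beta> k) b)"
      "interval_family {b..c} N (\<lambda>k. max (\<alpha> k) b) (\<lambda>k. max (\<beta> k) b)"
      using assms(1,2) by (intro interval_family_mono_image[OF family]; force intro!: monoI)+
    have "(\<Sum>k<N. min (\<beta> k) b - min (\<alpha> k) b) \<le> (\<Sum>k<N. \<beta> k - \<alpha> k)"
      "(\<Sum>k<N. max (\<beta> k) b - max (\<alpha> k) b) \<le> (\<Sum>k<N. \<beta> k - \<alpha> k)"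
      using interval_family_endpoints(1)[OF family] by (intro sum_mono; force simp: min_def max_def)+
    then have "(\<Sum>k<N. \<bar>h (min (\<beta> k) b) - h (min (\<alpha> k) b)\<bar>) < e / 2"
      "(\<Sum>k<N. \<bar>h (max (\<beta> k) b) - h (max (\<alpha> k) b)\<bar>) < e / 2"
      using \<delta>(2,4) clamped short unfolding small_variation_def by simp_all
    moreover have "(\<Sum>k<N. \<bar>h (\<beta> k) - h (\<alpha> k)\<bar>) \<le>
        (\<Sum>k<N. \<bar>h (min (\<beta> k) b) - h (min (\<alpha> k) b)\<bar> + \<bar>h (max (\<beta> k) b) - h (max (\<alpha> k) b)\<bar>)"
      using interval_family_endpoints(1)[OF family] by (intro sum_mono) (auto simp: min_def max_def)
    ultimately show "(\<Sum>k<N. \<bar>h (\<beta> k) - h (\<alpha> k)\<bar>) < e"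
      by (simp add: sum.distrib)
  qed
  then show "\<exists>\<delta>>0. small_variation {a..c} h \<delta> e"
    using \<delta> by (intro exI[of _ "min \<delta>1 \<delta>2"]) auto
qed

lemma abs_cont_on_localI:
  assumes "a \<le> b"
    and local: "\<And>t. a \<le> t \<Longrightarrow> t \<le> b \<Longrightarrow>
      \<exists>d>0. \<forall>\<alpha> \<beta>. a \<le> \<alpha> \<and> \<alpha> \<le> t \<and> t \<le> \<beta> \<and> \<beta> \<le> b \<and> \<beta> - \<alpha> < d \<longrightarrow> abs_cont_on {\<alpha>..\<beta>} h"
  shows "abs_cont_on {a..b} h"
proof -
  have "a \<le> a \<and> b \<le> b \<longrightarrow> abs_cont_on {a..b} h"
  proof (rule Bolzano[where P = "\<lambda>s t. a \<le> s \<and> t \<le> b \<longrightarrow> abs_cont_on {s..t} h", OF \<open>a \<le> b\<close>])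
    fix t assume "a \<le> t" "t \<le> b"
    then show "\<exists>d>0. \<forall>\<alpha> \<beta>. \<alpha> \<le> t \<and> t \<le> \<beta> \<and> \<beta> - \<alpha> < d \<longrightarrow> (a \<le> \<alpha> \<and> \<beta> \<le> b \<longrightarrow> abs_cont_on {\<alpha>..\<beta>} h)"
      using local[of t] by meson
  qed (auto intro: abs_cont_on_concat)
  then show ?thesis by simp
qed

section \<open>Monotonicity from one-sided derivatives\<close>

definition left_Dini_le :: "(real \<Rightarrow> real) \<Rightarrow> real \<Rightarrow> real \<Rightarrow> bool" where
  "left_Dini_le h t D \<longleftrightarrow> (\<forall>\<epsilon>>0. \<forall>\<^sub>F u in at_left t. h t - h u \<le> (D + \<epsilon>) * (t - u))"

lemma has_real_derivative_imp_left_Dini_le: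
  assumes "(h has_real_derivative D) (at t)" "D \<le> E"
  shows "left_Dini_le h t E"
  unfolding left_Dini_le_def
proof (intro allI impI)
  fix \<epsilon> :: real assume "\<epsilon> > 0"
  have "((\<lambda>u. (h u - h t) / (u - t)) \<longlongrightarrow> D) (at_left t)"
    using assms(1) by (simp add: has_field_derivative_iff filterlim_at_split)
  then have "\<forall>\<^sub>F u in at_left t. (h u - h t) / (u - t) < E + \<epsilon>"
    using \<open>\<epsilon> > 0\<close> assms(2) by (intro order_tendstoD) auto
  moreover have "\<forall>\<^sub>F u in at_left t. u < t" by (simp add: eventually_at_filter)
  ultimately show "\<forall>\<^sub>F u in at_left t. h t - h u \<le> (E + \<epsilon>) * (t - u)"
  proof eventually_elim
    case (elim u)
    then have "(h t - h u) / (t - u) < E + \<epsilon>"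
      using minus_divide_divide[of "h u - h t" "u - t"] by simp
    then show ?case using elim by (simp add: pos_divide_less_eq less_imp_le)
  qed
qed

lemma left_Dini_le_add:
  assumes "left_Dini_le h t D" "left_Dini_le k t E"
  shows "left_Dini_le (\<lambda>t. h t + k t) t (D + E)"
  unfolding left_Dini_le_def
proof (intro allI impI)
  fix \<epsilon> :: real assume "\<epsilon> > 0"
  then have "\<forall>\<^sub>F u in at_left t. h t - h u \<le> (D + \<epsilon> / 2) * (t - u)"
    "\<forall>\<^sub>F u in at_left t. k t - k u \<le> (E + \<epsilon> / 2) * (t - u)"
    using assms by (simp_all add: left_Dini_le_def)
  then show "\<forall>\<^sub>F u in at_left t. h t + k t - (h u + k u) \<le> (D + E + \<epsilon>) * (t - u)"
    by eventually_elim (simp add: field_simps)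
qed

lemma left_Dini_le_dominated:
  assumes "left_Dini_le k t D" "\<forall>\<^sub>F u in at_left t. h t - h u \<le> k t - k u"
  shows "left_Dini_le h t D"
  unfolding left_Dini_le_def
proof (intro allI impI)
  fix \<epsilon> :: real assume "\<epsilon> > 0"
  then have "\<forall>\<^sub>F u in at_left t. k t - k u \<le> (D + \<epsilon>) * (t - u)"
    using assms(1) by (simp add: left_Dini_le_def)
  with assms(2) show "\<forall>\<^sub>F u in at_left t. h t - h u \<le> (D + \<epsilon>) * (t - u)"
    by eventually_elim simp
qed

lemma left_nonincreasing_imp_le:
  fixes H :: "real \<Rightarrow> real"
  assumes "a \<le> b"
    and left: "\<And>t. a < t \<Longrightarrow> t \<le> b \<Longrightarrow> \<forall>\<^sub>F u in at_left t. H t \<le> H u"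
    and right: "\<And>t c. a \<le> t \<Longrightarrow> t < b \<Longrightarrow> H t < c \<Longrightarrow> \<forall>\<^sub>F u in at_right t. H u < c"
  shows "H b \<le> H a"
proof -
  define S where "S = {u \<in> {a..b}. H b \<le> H u}"
  define s where "s = Inf S"
  have b_in_S: "b \<in> S" using \<open>a \<le> b\<close> by (simp add: S_def)
  have bdd: "bdd_below S" by (rule bdd_belowI[of _ a]) (auto simp: S_def)
  have s: "a \<le> s" "s \<le> b"
    unfolding s_def using b_in_S bdd by (auto intro!: cInf_greatest cInf_lower simp: S_def)
  have le_at_s: "H b \<le> H s"
  proof (rule ccontr)
    assume less: "\<not> H b \<le> H s"
    then have "s < b" using s by (cases "s = b") auto
    then obtain r where r: "r > s" "\<And>u. s < u \<Longrightarrow> u < r \<Longrightarrow> H u < H b"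
      using right[of s "H b"] s less by (auto simp: eventually_at_right_field)
    obtain u where u: "u \<in> S" "u < r" using cInf_lessD[of S r] b_in_S r(1) by (auto simp: s_def)
    have "s \<le> u" unfolding s_def using u bdd by (intro cInf_lower)
    then show False using r(2)[of u] u less by (cases "u = s") (auto simp: S_def)
  qed
  have "s = a"
  proof (rule ccontr)
    assume "s \<noteq> a"
    then have "a < s" using s by simp
    then obtain r where "r < s" "\<And>u. r < u \<Longrightarrow> u < s \<Longrightarrow> H s \<le> H u"
      using left[of s] s by (auto simp: eventually_at_left_field)
    moreover obtain u where "max a r < u" "u < s"
      using dense[of "max a r" s] \<open>a < s\<close> \<open>r < s\<close> by auto
    ultimately have "H s \<le> H u" by simp
    then have "u \<in> S" using le_at_s s \<open>max a r < u\<close> \<open>u < s\<close> by (simp add: S_def)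
    then have "s \<le> u" unfolding s_def using bdd by (intro cInf_lower)
    then show False using \<open>u < s\<close> by simp
  qed
  then show ?thesis using le_at_s by simp
qed

definition variation_sums :: "real set \<Rightarrow> (real \<Rightarrow> real) \<Rightarrow> real set" where
  "variation_sums S h = {\<Sum>k<N. \<bar>h (\<beta> k) - h (\<alpha> k)\<bar> | N \<alpha> \<beta>. interval_family S N \<alpha> \<beta>}"

definition variation :: "real set \<Rightarrow> (real \<Rightarrow> real) \<Rightarrow> real" where
  "variation S h = Sup (variation_sums S h)"

lemma zero_in_variation_sums: "0 \<in> variation_sums S h"
  unfolding variation_sums_def by (rule CollectI, rule exI[of _ 0]) (auto simp: interval_family_def)

lemma variation_sums_mono: "S \<subseteq> T \<Longrightarrow> variation_sums S h \<subseteq> variation_sums T h"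
  unfolding variation_sums_def using interval_family_subset by blast

lemma variation_nonneg: "bdd_above (variation_sums S h) \<Longrightarrow> 0 \<le> variation S h"
  unfolding variation_def by (intro cSup_upper zero_in_variation_sums)

lemma variation_mono:
  assumes "bdd_above (variation_sums T h)" "S \<subseteq> T"
  shows "variation S h \<le> variation T h"
  unfolding variation_def using zero_in_variation_sums assms
  by (intro cSup_subset_mono variation_sums_mono) auto

lemma variation_extend:
  assumes bdd: "bdd_above (variation_sums T h)" and "S \<subseteq> T" "u \<le> t" "{u..t} \<subseteq> T" "S \<subseteq> {..u}"
  shows "variation S h + \<bar>h t - h u\<bar> \<le> variation T h"
proof -
  have "v \<le> variation T h - \<bar>h t - h u\<bar>" if v: "v \<in> variation_sums S h" for v
  proof -
    obtain N \<alpha> \<beta> where family: "interval_family S N \<alpha> \<beta>" and v: "v = (\<Sum>k<N. \<bar>h (\<beta> k) - h (\<alpha> k)\<bar>)"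
      using v unfolding variation_sums_def by blast
    have before: "\<beta> k \<le> u" if "k < N" for k
      using interval_family_endpoints(3)[OF family that] \<open>S \<subseteq> {..u}\<close> by auto
    have "interval_family T (Suc N) (\<alpha>(N := u)) (\<beta>(N := t))"
      using interval_family_subset[OF family \<open>S \<subseteq> T\<close>] assms(3,4) before
      unfolding interval_family_def by (auto simp: less_Suc_eq)
    then have "(\<Sum>k<Suc N. \<bar>h ((\<beta>(N := t)) k) - h ((\<alpha>(N := u)) k)\<bar>) \<in> variation_sums T h"
      unfolding variation_sums_def by blast
    then have "v + \<bar>h t - h u\<bar> \<in> variation_sums T h" by (simp add: v)
    then have "v + \<bar>h t - h u\<bar> \<le> variation T h"
      unfolding variation_def using bdd by (rule cSup_upper)
    then show ?thesis by simp
  qed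
  then have "variation S h \<le> variation T h - \<bar>h t - h u\<bar>"
    unfolding variation_def[of S] using zero_in_variation_sums by (intro cSup_least) auto
  then show ?thesis by simp
qed

lemma interval_family_length_le_measure:
  assumes "open G" "G \<in> lmeasurable" and family: "interval_family G N \<alpha> \<beta>"
  shows "(\<Sum>k<N. \<beta> k - \<alpha> k) \<le> measure lebesgue G"
proof -
  have "(\<Sum>k<N. \<beta> k - \<alpha> k) = (\<Sum>k<N. measure lebesgue {\<alpha> k<..<\<beta> k})"
    using interval_family_endpoints(1)[OF family] by (intro sum.cong) auto
  also have "\<dots> = measure lebesgue (\<Union>k<N. {\<alpha> k<..<\<beta> k})"
  proof (rule measure_finite_Union[symmetric])
    show "disjoint_family_on (\<lambda>k. {\<alpha> k<..<\<beta> k}) {..<N}"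
      unfolding disjoint_family_on_def
    proof (intro ballI impI)
      fix k k' assume "k \<in> {..<N}" "k' \<in> {..<N}" "k \<noteq> k'"
      then show "{\<alpha> k<..<\<beta> k} \<inter> {\<alpha> k'<..<\<beta> k'} = {}"
        using interval_family_nonoverlapping[OF family, of k k'] by auto
    qed
  qed (use interval_family_endpoints(1)[OF family] in auto)
  also have "\<dots> \<le> measure lebesgue G"
  proof (rule measure_mono_fmeasurable)
    show "(\<Union>k<N. {\<alpha> k<..<\<beta> k}) \<subseteq> G"
      using family by (force simp: interval_family_def subset_iff)
  qed (use assms in auto)
  finally show ?thesis .
qed

lemma variation_small:
  assumes small: "small_variation S h \<delta> e" and G: "open G" "G \<in> lmeasurable" "measure lebesgue G < \<delta>"
    and T: "T \<subseteq> S \<inter> G"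
  shows "bdd_above (variation_sums T h)" "variation T h \<le> e"
proof -
  have le: "v \<le> e" if "v \<in> variation_sums T h" for v
  proof -
    from that obtain N \<alpha> \<beta> where family: "interval_family T N \<alpha> \<beta>"
      and v: "v = (\<Sum>k<N. \<bar>h (\<beta> k) - h (\<alpha> k)\<bar>)"
      unfolding variation_sums_def by blast
    have "(\<Sum>k<N. \<beta> k - \<alpha> k) \<le> measure lebesgue G"
      using G T by (intro interval_family_length_le_measure interval_family_subset[OF family]) auto
    also note G(3)
    finally have "(\<Sum>k<N. \<beta> k - \<alpha> k) < \<delta>" .
    moreover have "interval_family S N \<alpha> \<beta>"
      using T by (intro interval_family_subset[OF family]) auto
    ultimately show ?thesis
      using small unfolding small_variation_def v by (blast intro: less_imp_le)
  qed
  show "bdd_above (variation_sums T h)" using le by (rule bdd_aboveI)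
  show "variation T h \<le> e"
    unfolding variation_def using zero_in_variation_sums le by (intro cSup_least) auto
qed

lemma null_set_open_cover:
  assumes N: "N \<in> null_sets lebesgue" and "\<delta> > 0"
  obtains G where "open G" "N \<subseteq> G" "G \<in> lmeasurable" "measure lebesgue G < \<delta>"
proof -
  obtain G where G: "open G" "N \<subseteq> G" "G - N \<in> lmeasurable" "emeasure lebesgue (G - N) < ennreal \<delta>"
    using sets_lebesgue_outer_open[of N \<delta>] assms by auto
  have "G \<in> sets lebesgue" using G(1) by simp
  then have "emeasure lebesgue G < ennreal \<delta>"
    using G(4) emeasure_Diff_null_set[OF N, of G] by simp
  moreover from this have "G \<in> lmeasurable"
    using \<open>G \<in> sets lebesgue\<close> by (intro fmeasurableI)
      (simp_all add: order.strict_trans[OF _ ennreal_less_top])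
  ultimately have "measure lebesgue G < \<delta>"
    using \<open>\<delta> > 0\<close> by (simp add: emeasure_eq_measure2 ennreal_less_iff)
  then show thesis using that G(1,2) \<open>G \<in> lmeasurable\<close> by blast
qed

lemma abs_cont_on_increments_absorbed:
  assumes abs_cont: "abs_cont_on {a..b} h" and "\<epsilon> > 0" and N: "N \<in> null_sets lebesgue"
  obtains G \<psi> where "open G" "N \<subseteq> G" "mono_on {a..b} \<psi>" "\<And>t. t \<in> {a..b} \<Longrightarrow> 0 \<le> \<psi> t \<and> \<psi> t \<le> \<epsilon>"
    "\<And>u t. a \<le> u \<Longrightarrow> u \<le> t \<Longrightarrow> t \<le> b \<Longrightarrow> {u..t} \<subseteq> G \<Longrightarrow> \<psi> u + \<bar>h t - h u\<bar> \<le> \<psi> t"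
proof -
  obtain \<delta> where "\<delta> > 0" and small: "small_variation {a..b} h \<delta> \<epsilon>"
    using abs_cont \<open>\<epsilon> > 0\<close> by (auto simp: abs_cont_on_iff)
  obtain G where G: "open G" "N \<subseteq> G" "G \<in> lmeasurable" "measure lebesgue G < \<delta>"
    using N \<open>\<delta> > 0\<close> by (rule null_set_open_cover)
  define \<psi> where "\<psi> t = variation (G \<inter> {a..t}) h" for t
  have sub: "G \<inter> {a..t} \<subseteq> {a..b} \<inter> G" if "t \<le> b" for t
    using that by auto
  have bdd: "bdd_above (variation_sums (G \<inter> {a..t}) h)" and "\<psi> t \<le> \<epsilon>" if "t \<le> b" for t
    unfolding \<psi>_def using variation_small[OF small G(1,3,4) sub[OF that]] by simp_all
  moreover have "0 \<le> \<psi> t" if "t \<le> b" for t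
    unfolding \<psi>_def by (intro variation_nonneg bdd that)
  moreover have "mono_on {a..b} \<psi>"
    unfolding \<psi>_def by (intro mono_onI variation_mono bdd) auto
  moreover have "\<psi> u + \<bar>h t - h u\<bar> \<le> \<psi> t" if "a \<le> u" "u \<le> t" "t \<le> b" "{u..t} \<subseteq> G" for u t
    unfolding \<psi>_def using that by (intro variation_extend bdd) auto
  ultimately show thesis using G(1,2) by (intro that[of G \<psi>]) auto
qed

lemma eventually_at_right_continuous_diff_mono_less:
  fixes k \<psi> :: "real \<Rightarrow> real"
  assumes "continuous_on {t..b} k" "mono_on {t..b} \<psi>" "t < b" "k t - \<psi> t < c"
  shows "\<forall>\<^sub>F u in at_right t. k u - \<psi> u < c"
proof -
  have "(k \<longlongrightarrow> k t) (at_right t)"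
    using assms(1,3) by (rule continuous_on_Icc_at_rightD)
  then have "\<forall>\<^sub>F u in at_right t. k u < c + \<psi> t"
    using assms(4) by (intro order_tendstoD) auto
  moreover have "\<forall>\<^sub>F u in at_right t. t < u \<and> u < b"
    using assms(3) by (intro eventually_at_rightI[of _ b]) auto
  ultimately show ?thesis
  proof eventually_elim
    case (elim u)
    then show ?case using mono_onD[OF assms(2), of t u] by simp
  qed
qed

lemma absorbed_imp_left_nonincreasing:
  fixes h :: "real \<Rightarrow> real"
  assumes "open G" "t \<in> G" "a < t" "\<epsilon> > 0"
    and absorb: "\<And>u. a \<le> u \<Longrightarrow> u \<le> t \<Longrightarrow> {u..t} \<subseteq> G \<Longrightarrow> \<psi> u + \<bar>h t - h u\<bar> \<le> \<psi> t"
  shows "\<forall>\<^sub>F u in at_left t. (h t - \<epsilon> * t) - \<psi> t \<le> (h u - \<epsilon> * u) - \<psi> u"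
proof -
  obtain r where r: "r > 0" "ball t r \<subseteq> G"
    using assms(1,2) by (auto simp: open_contains_ball)
  then have "\<forall>\<^sub>F u in at_left t. max a (t - r) < u \<and> u < t"
    using \<open>a < t\<close> by (intro eventually_at_leftI[of "max a (t - r)"]) auto
  then show ?thesis
  proof eventually_elim
    case (elim u)
    then have "{u..t} \<subseteq> ball t r" by (auto simp: dist_real_def)
    then have "\<psi> u + \<bar>h t - h u\<bar> \<le> \<psi> t" using elim r by (intro absorb) auto
    moreover have "\<epsilon> * u \<le> \<epsilon> * t" using \<open>\<epsilon> > 0\<close> elim by simp
    ultimately show ?case by linarith
  qed
qed

text \<open>On an open set \<open>G\<close> covering the exceptional times the increments of \<open>h\<close> are absorbed by the
  small nondecreasing function \<open>\<psi>\<close>; elsewhere the slope \<open>\<epsilon>\<close> dominates them.\<close>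

lemma abs_cont_on_left_Dini_nonpos_imp_le_add:
  assumes "a \<le> b" and abs_cont: "abs_cont_on {a..b} h" and "\<epsilon> > 0"
    and Dini: "AE t in lebesgue. a < t \<and> t < b \<longrightarrow> left_Dini_le h t 0"
  shows "h b \<le> h a + \<epsilon> * (b - a) + \<epsilon>"
proof -
  obtain N where N: "N \<in> null_sets lebesgue"
      "\<And>t. t \<notin> N \<Longrightarrow> a < t \<and> t < b \<longrightarrow> left_Dini_le h t 0"
    by (rule AE_E3[OF Dini]) simp
  have "N \<union> {b} \<in> null_sets lebesgue"
    by (intro null_sets.Un N(1)) (auto intro: finite_imp_null_set_lborel null_sets_completionI)
  then obtain G \<psi> where G: "open G" "N \<union> {b} \<subseteq> G" and mono: "mono_on {a..b} \<psi>"
    and bounds: "\<And>t. t \<in> {a..b} \<Longrightarrow> 0 \<le> \<psi> t \<and> \<psi> t \<le> \<epsilon>"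
    and absorb: "\<And>u t. a \<le> u \<Longrightarrow> u \<le> t \<Longrightarrow> t \<le> b \<Longrightarrow> {u..t} \<subseteq> G \<Longrightarrow> \<psi> u + \<bar>h t - h u\<bar> \<le> \<psi> t"
    using abs_cont_on_increments_absorbed[OF abs_cont \<open>\<epsilon> > 0\<close>] by blast
  have "(h b - \<epsilon> * b) - \<psi> b \<le> (h a - \<epsilon> * a) - \<psi> a"
  proof (rule left_nonincreasing_imp_le[where H = "\<lambda>t. (h t - \<epsilon> * t) - \<psi> t", OF \<open>a \<le> b\<close>])
    fix t assume t: "a < t" "t \<le> b"
    show "\<forall>\<^sub>F u in at_left t. (h t - \<epsilon> * t) - \<psi> t \<le> (h u - \<epsilon> * u) - \<psi> u"
    proof (cases "t \<in> G")
      case True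
      then show ?thesis
        using absorb t by (intro absorbed_imp_left_nonincreasing[OF G(1) _ t(1) \<open>\<epsilon> > 0\<close>]) auto
    next
      case False
      then have "t < b" "t \<notin> N" using t G(2) by (auto simp: less_le)
      then have "\<forall>\<^sub>F u in at_left t. h t - h u \<le> (0 + \<epsilon>) * (t - u)"
        using N(2) t \<open>\<epsilon> > 0\<close> unfolding left_Dini_le_def by blast
      moreover have "\<forall>\<^sub>F u in at_left t. a < u \<and> u < t"
        using t by (intro eventually_at_leftI[of a]) auto
      ultimately show ?thesis
      proof eventually_elim
        case (elim u)
        then show ?case using mono_onD[OF mono, of u t] t by (simp add: algebra_simps)
      qed
    qed
  next
    fix t c assume t: "a \<le> t" "t < b" and "(h t - \<epsilon> * t) - \<psi> t < c"
    moreover have "continuous_on {t..b} (\<lambda>t. h t - \<epsilon> * t)"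
      using t by (intro continuous_intros abs_cont_on_imp_continuous_on abs_cont_on_subset[OF abs_cont]) auto
    moreover have "mono_on {t..b} \<psi>" using mono t by (auto intro: mono_on_subset)
    ultimately show "\<forall>\<^sub>F u in at_right t. (h u - \<epsilon> * u) - \<psi> u < c"
      by (intro eventually_at_right_continuous_diff_mono_less)
  qed
  then show ?thesis using bounds[of a] bounds[of b] \<open>a \<le> b\<close> by (simp add: algebra_simps)
qed

lemma abs_cont_on_left_Dini_nonpos_imp_le:
  assumes "a \<le> b" "abs_cont_on {a..b} h" "AE t in lebesgue. a < t \<and> t < b \<longrightarrow> left_Dini_le h t 0"
  shows "h b \<le> h a"
proof -
  have "((\<lambda>\<epsilon>. h a + \<epsilon> * (b - a) + \<epsilon>) \<longlongrightarrow> h a + 0 * (b - a) + 0) (at_right 0)"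
    by (intro tendsto_intros)
  moreover have "\<forall>\<^sub>F \<epsilon> in at_right 0. h b \<le> h a + \<epsilon> * (b - a) + \<epsilon>"
    using abs_cont_on_left_Dini_nonpos_imp_le_add[OF assms(1,2) _ assms(3)]
    by (auto simp: eventually_at_filter)
  ultimately have "h b \<le> h a + 0 * (b - a) + 0"
    by (rule tendsto_lowerbound) simp
  then show ?thesis by simp
qed

section \<open>Lagrange multipliers for affine constraints\<close>

text \<open>\<open>C \<theta> u v\<close> stands for the convex combination \<open>(1 - \<theta>) u + \<theta> v\<close> on a type without vector space
  structure: \<open>comb\<close> for vectors, \<open>comb2\<close> for block vectors.\<close>

definition mix_closed :: "(real \<Rightarrow> 'v \<Rightarrow> 'v \<Rightarrow> 'v) \<Rightarrow> 'v set \<Rightarrow> bool" where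
  "mix_closed C K \<longleftrightarrow> (\<forall>u\<in>K. \<forall>v\<in>K. \<forall>\<theta>\<in>{0..1}. C \<theta> u v \<in> K)"

definition mix_convex_on :: "(real \<Rightarrow> 'v \<Rightarrow> 'v \<Rightarrow> 'v) \<Rightarrow> 'v set \<Rightarrow> ('v \<Rightarrow> real) \<Rightarrow> bool" where
  "mix_convex_on C K \<Phi> \<longleftrightarrow>
     (\<forall>u\<in>K. \<forall>v\<in>K. \<forall>\<theta>\<in>{0..1}. \<Phi> (C \<theta> u v) \<le> (1 - \<theta>) * \<Phi> u + \<theta> * \<Phi> v)"

definition mix_affine_on :: "(real \<Rightarrow> 'v \<Rightarrow> 'v \<Rightarrow> 'v) \<Rightarrow> 'v set \<Rightarrow> ('v \<Rightarrow> real) \<Rightarrow> bool" where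
  "mix_affine_on C K c \<longleftrightarrow>
     (\<forall>u\<in>K. \<forall>v\<in>K. \<forall>\<theta>\<in>{0..1}. c (C \<theta> u v) = (1 - \<theta>) * c u + \<theta> * c v)"

lemma mix_convex_onD:
  "mix_convex_on C K \<Phi> \<Longrightarrow> u \<in> K \<Longrightarrow> v \<in> K \<Longrightarrow> 0 \<le> \<theta> \<Longrightarrow> \<theta> \<le> 1 \<Longrightarrow>
    \<Phi> (C \<theta> u v) \<le> (1 - \<theta>) * \<Phi> u + \<theta> * \<Phi> v"
  by (simp add: mix_convex_on_def)

lemma mix_convex_on_diff_affine_sum:
  assumes "mix_convex_on C K \<Phi>" "\<And>r. r \<in> I \<Longrightarrow> mix_affine_on C K (c r)"
  shows "mix_convex_on C K (\<lambda>y. \<Phi> y - (\<Sum>r\<in>I. \<mu> r * c r y))"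
  unfolding mix_convex_on_def
proof (intro ballI)
  fix u v \<theta> assume uv: "u \<in> K" "v \<in> K" "\<theta> \<in> {0..1::real}"
  have "(\<Sum>r\<in>I. \<mu> r * c r (C \<theta> u v)) = (\<Sum>r\<in>I. (1 - \<theta>) * (\<mu> r * c r u) + \<theta> * (\<mu> r * c r v))"
  proof (rule sum.cong)
    fix r assume "r \<in> I"
    then have "c r (C \<theta> u v) = (1 - \<theta>) * c r u + \<theta> * c r v"
      using assms(2) uv unfolding mix_affine_on_def by blast
    then show "\<mu> r * c r (C \<theta> u v) = (1 - \<theta>) * (\<mu> r * c r u) + \<theta> * (\<mu> r * c r v)"
      by (simp only:) (simp add: algebra_simps)
  qed simp
  also have "\<dots> = (1 - \<theta>) * (\<Sum>r\<in>I. \<mu> r * c r u) + \<theta> * (\<Sum>r\<in>I. \<mu> r * c r v)"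
    by (simp add: sum.distrib sum_distrib_left)
  finally have affine: "(\<Sum>r\<in>I. \<mu> r * c r (C \<theta> u v)) = \<dots>" .
  have "\<Phi> (C \<theta> u v) \<le> (1 - \<theta>) * \<Phi> u + \<theta> * \<Phi> v"
    using assms(1) uv by (simp add: mix_convex_onD)
  then show "\<Phi> (C \<theta> u v) - (\<Sum>r\<in>I. \<mu> r * c r (C \<theta> u v)) \<le>
      (1 - \<theta>) * (\<Phi> u - (\<Sum>r\<in>I. \<mu> r * c r u)) + \<theta> * (\<Phi> v - (\<Sum>r\<in>I. \<mu> r * c r v))"
    unfolding affine by (simp add: algebra_simps)
qed

lemma slope_le_of_nonneg_on_kernel:
  assumes mix: "mix_closed C K" "mix_convex_on C K \<Phi>" "mix_affine_on C K c"
    and nonneg: "\<And>y. y \<in> K \<Longrightarrow> c y = 0 \<Longrightarrow> 0 \<le> \<Phi> y"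
    and uv: "u \<in> K" "v \<in> K" "c u > 0" "c v < 0"
  shows "\<Phi> v / c v \<le> \<Phi> u / c u"
proof -
  define \<theta> where "\<theta> = c u / (c u - c v)"
  have pos: "c u - c v > 0" using uv by simp
  have \<theta>: "\<theta> \<in> {0..1}" "1 - \<theta> = - c v / (c u - c v)"
    using uv pos by (auto simp: \<theta>_def field_simps)
  have "c (C \<theta> u v) = (1 - \<theta>) * c u + \<theta> * c v"
    using mix(3) uv(1,2) \<theta>(1) unfolding mix_affine_on_def by blast
  also have "\<dots> = 0" unfolding \<theta>(2) by (simp add: \<theta>_def)
  finally have "0 \<le> \<Phi> (C \<theta> u v)"
    using mix(1) uv(1,2) \<theta>(1) by (intro nonneg) (auto simp: mix_closed_def)
  also have "\<dots> \<le> (1 - \<theta>) * \<Phi> u + \<theta> * \<Phi> v"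
    using mix(2) uv(1,2) \<theta>(1) by (simp add: mix_convex_onD)
  also have "\<dots> = (\<Phi> v * c u - \<Phi> u * c v) / (c u - c v)"
    unfolding \<theta>(2) by (simp add: \<theta>_def add_divide_distrib diff_divide_distrib mult.commute)
  finally have "0 \<le> \<Phi> v * c u - \<Phi> u * c v" using pos by (simp add: zero_le_divide_iff)
  then show ?thesis using uv by (simp add: field_simps)
qed

lemma affine_multiplier:
  assumes mix: "mix_closed C K" "mix_convex_on C K \<Phi>" "mix_affine_on C K c"
    and opposite: "\<And>y. y \<in> K \<Longrightarrow> \<exists>y'\<in>K. \<exists>s>0. c y' = - s * c y"
    and nonneg: "\<And>y. y \<in> K \<Longrightarrow> c y = 0 \<Longrightarrow> 0 \<le> \<Phi> y"
  shows "\<exists>\<tau>. \<forall>y\<in>K. \<tau> * c y \<le> \<Phi> y"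
proof (cases "\<exists>u\<in>K. c u > 0")
  case False
  have "c y = 0" if "y \<in> K" for y
  proof -
    obtain y' s where "y' \<in> K" "s > 0" "c y' = - s * c y"
      using opposite[OF \<open>y \<in> K\<close>] by blast
    then have "c y \<le> 0" "0 \<le> s * c y"
      using False \<open>y \<in> K\<close> by (auto simp: not_less)
    then show ?thesis using \<open>s > 0\<close> by (simp add: zero_le_mult_iff)
  qed
  then show ?thesis using nonneg by (intro exI[of _ 0]) auto
next
  case True
  then obtain u v where u: "u \<in> K" "c u > 0" and v: "v \<in> K" "c v < 0"
    using opposite by (metis mult_minus_left mult_pos_pos neg_less_0_iff_less)
  have slope_le: "\<Phi> v / c v \<le> \<Phi> u / c u" if "u \<in> K" "v \<in> K" "c u > 0" "c v < 0" for u v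
    using nonneg that by (intro slope_le_of_nonneg_on_kernel[OF mix])
  define A where "A = (\<lambda>v. \<Phi> v / c v) ` {v \<in> K. c v < 0}"
  have bdd: "bdd_above A"
    using slope_le[OF u(1) _ u(2)] by (intro bdd_aboveI[of _ "\<Phi> u / c u"]) (auto simp: A_def)
  have "Sup A * c y \<le> \<Phi> y" if y: "y \<in> K" for y
  proof (cases "c y" "0::real" rule: linorder_cases)
    case less
    then have "\<Phi> y / c y \<le> Sup A" using y bdd by (intro cSup_upper) (auto simp: A_def)
    then show ?thesis using less by (simp add: neg_divide_le_eq)
  next
    case equal
    then show ?thesis using nonneg y by simp
  next
    case greater
    then have "Sup A \<le> \<Phi> y / c y"
      using slope_le y v by (intro cSup_least) (auto simp: A_def)
    then show ?thesis using greater by (simp add: pos_le_divide_eq)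
  qed
  then show ?thesis by blast
qed

lemma affine_multipliers:
  fixes c :: "nat \<Rightarrow> 'v \<Rightarrow> real" and \<Phi> :: "'v \<Rightarrow> real"
  assumes "mix_closed C K" "mix_convex_on C K \<Phi>" "\<And>r. r < m \<Longrightarrow> mix_affine_on C K (c r)"
    and "\<And>y. y \<in> K \<Longrightarrow> \<exists>y'\<in>K. \<exists>s>0. \<forall>r<m. c r y' = - s * c r y"
    and "\<And>y. y \<in> K \<Longrightarrow> \<forall>r<m. c r y = 0 \<Longrightarrow> 0 \<le> \<Phi> y"
  shows "\<exists>\<mu>. \<forall>y\<in>K. (\<Sum>r<m. \<mu> r * c r y) \<le> \<Phi> y"
  using assms
proof (induction m arbitrary: K)
  case 0
  then show ?case by auto
next
  case (Suc m)
  note closed = Suc.prems(1) and convex = Suc.prems(2) and affine = Suc.prems(3)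
    and opposite = Suc.prems(4) and nonneg = Suc.prems(5)
  define K' where "K' = {y \<in> K. c m y = 0}"
  have "\<exists>\<mu>. \<forall>y\<in>K'. (\<Sum>r<m. \<mu> r * c r y) \<le> \<Phi> y"
  proof (rule Suc.IH)
    show "mix_closed C K'"
      using closed affine[of m] by (simp add: K'_def mix_closed_def mix_affine_on_def)
    show "mix_convex_on C K' \<Phi>" "\<And>r. r < m \<Longrightarrow> mix_affine_on C K' (c r)"
      using convex affine by (simp_all add: K'_def mix_convex_on_def mix_affine_on_def)
    show "\<exists>y'\<in>K'. \<exists>s>0. \<forall>r<m. c r y' = - s * c r y" if y: "y \<in> K'" for y
    proof -
      obtain y' s where "y' \<in> K" "s > 0" "\<forall>r<Suc m. c r y' = - s * c r y"
        using opposite[of y] y unfolding K'_def by blast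
      then show ?thesis using y unfolding K'_def by (auto intro!: bexI[of _ y'] exI[of _ s])
    qed
    show "0 \<le> \<Phi> y" if "y \<in> K'" "\<forall>r<m. c r y = 0" for y
      using that nonneg[of y] by (auto simp: K'_def less_Suc_eq)
  qed
  then obtain \<mu> where \<mu>: "\<forall>y\<in>K'. (\<Sum>r<m. \<mu> r * c r y) \<le> \<Phi> y" by blast
  have "\<exists>\<tau>. \<forall>y\<in>K. \<tau> * c m y \<le> \<Phi> y - (\<Sum>r<m. \<mu> r * c r y)"
  proof (rule affine_multiplier[OF closed])
    show "mix_convex_on C K (\<lambda>y. \<Phi> y - (\<Sum>r<m. \<mu> r * c r y))"
      using affine by (intro mix_convex_on_diff_affine_sum convex) auto
    show "mix_affine_on C K (c m)" using affine by simp
    show "\<exists>y'\<in>K. \<exists>s>0. c m y' = - s * c m y" if "y \<in> K" for y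
      using opposite[OF that] by blast
    show "0 \<le> \<Phi> y - (\<Sum>r<m. \<mu> r * c r y)" if "y \<in> K" "c m y = 0" for y
      using \<mu> that by (simp add: K'_def)
  qed
  then obtain \<tau> where "\<forall>y\<in>K. \<tau> * c m y \<le> \<Phi> y - (\<Sum>r<m. \<mu> r * c r y)" by blast
  then have "\<forall>y\<in>K. (\<Sum>r<Suc m. (\<mu>(m := \<tau>)) r * c r y) \<le> \<Phi> y"
    by (auto simp: le_diff_eq add.commute)
  then show ?case by blast
qed

section \<open>Graph Laplacians\<close>

definition laplacian :: "nat \<Rightarrow> (nat \<Rightarrow> nat \<Rightarrow> real) \<Rightarrow> (nat \<Rightarrow> real) \<Rightarrow> nat \<Rightarrow> real" where
  "laplacian n a y i = (\<Sum>j<n. a i j * (y i - y j))"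

lemma laplacian_bilinear_form:
  assumes "weighted_graph n a"
  shows "(\<Sum>i<n. y i * laplacian n a v i) = (\<Sum>i<n. \<Sum>j<n. a i j * ((y i - y j) * (v i - v j))) / 2"
proof -
  have rows: "(\<Sum>i<n. y i * laplacian n a v i) = (\<Sum>i<n. \<Sum>j<n. a i j * (y i * (v i - v j)))"
    by (simp add: laplacian_def sum_distrib_left mult.left_commute)
  also have "\<dots> = (\<Sum>j<n. \<Sum>i<n. a i j * (y i * (v i - v j)))" by (rule sum.swap)
  also have "\<dots> = (\<Sum>i<n. \<Sum>j<n. a i j * (- y j * (v i - v j)))"
    using assms unfolding weighted_graph_def by (intro sum.cong refl) (auto simp: algebra_simps)
  finally have columns: "(\<Sum>i<n. y i * laplacian n a v i) = \<dots>" .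
  have "2 * (\<Sum>i<n. y i * laplacian n a v i) =
      (\<Sum>i<n. \<Sum>j<n. a i j * (y i * (v i - v j))) + (\<Sum>i<n. \<Sum>j<n. a i j * (- y j * (v i - v j)))"
    using rows columns by linarith
  also have "\<dots> = (\<Sum>i<n. \<Sum>j<n. a i j * ((y i - y j) * (v i - v j)))"
    by (simp add: sum.distrib[symmetric] algebra_simps)
  finally show ?thesis by simp
qed

lemma laplacian_self_adjoint:
  assumes "weighted_graph n a"
  shows "(\<Sum>i<n. y i * laplacian n a v i) = (\<Sum>i<n. v i * laplacian n a y i)"
  unfolding laplacian_bilinear_form[OF assms] by (simp add: mult.commute)

lemma laplacian_nonneg:
  assumes "weighted_graph n a"
  shows "0 \<le> (\<Sum>i<n. y i * laplacian n a y i)"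
  unfolding laplacian_bilinear_form[OF assms]
  using assms unfolding weighted_graph_def
  by (intro divide_nonneg_pos sum_nonneg mult_nonneg_nonneg[OF _ zero_le_square]) auto

lemma laplacian_eq_0_imp_const:
  assumes graph: "weighted_graph n a" "graph_connected n a"
    and harmonic: "\<forall>i<n. laplacian n a y i = 0" and ij: "i < n" "j < n"
  shows "y i = y j"
proof -
  let ?edges = "{..<n} \<times> {..<n}"
  have "(\<Sum>(u, v)\<in>?edges. a u v * ((y u - y v) * (y u - y v))) = 0"
    using laplacian_bilinear_form[OF graph(1), of y y] harmonic by (simp add: sum.cartesian_product)
  moreover have "0 \<le> a u v * ((y u - y v) * (y u - y v))" if "u < n" "v < n" for u v
    using graph(1) that by (simp add: weighted_graph_def)
  ultimately have "\<forall>(u, v)\<in>?edges. a u v * ((y u - y v) * (y u - y v)) = 0"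
    by (subst (asm) sum_nonneg_eq_0_iff) auto
  then have edge: "y u = y v" if "u < n" "v < n" "a u v > 0" for u v
    using that by force
  have "(i, j) \<in> {(u, v). u < n \<and> v < n \<and> a u v > 0}\<^sup>*"
    using graph(2) ij unfolding graph_connected_def by blast
  then show ?thesis by (induction rule: rtrancl_induct) (use edge in auto)
qed

text \<open>The potential \<open>v\<close> is the multiplier vector of the constraints \<open>laplacian y = 0\<close> for the
  linear objective \<open>b\<close>, which vanishes on the constant vectors.\<close>

lemma laplacian_solvable:
  assumes graph: "weighted_graph n a" "graph_connected n a" and balanced: "(\<Sum>i<n. b i) = 0"
  shows "\<exists>v. \<forall>i<n. laplacian n a v i = b i"
proof -
  have lap_comb: "laplacian n a (comb \<theta> u v) r = (1 - \<theta>) * laplacian n a u r + \<theta> * laplacian n a v r"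
    for \<theta> u v r
    by (simp add: laplacian_def comb_def sum_distrib_left sum.distrib[symmetric] algebra_simps)
  have "\<exists>\<mu>. \<forall>y\<in>UNIV. (\<Sum>r<n. \<mu> r * laplacian n a y r) \<le> (\<Sum>i<n. b i * y i)"
  proof (rule affine_multipliers[where C = comb])
    show "mix_convex_on comb UNIV (\<lambda>y. \<Sum>i<n. b i * y i)"
      by (simp add: mix_convex_on_def comb_def sum_distrib_left sum.distrib[symmetric] algebra_simps)
    show "mix_affine_on comb UNIV (\<lambda>y. laplacian n a y r)" for r
      by (simp add: mix_affine_on_def lap_comb)
    show "\<exists>y'\<in>UNIV. \<exists>s>0. \<forall>r<n. laplacian n a y' r = - s * laplacian n a y r" for y
      by (intro bexI[of _ "\<lambda>i. - y i"] exI[of _ 1])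
         (simp_all add: laplacian_def sum_negf[symmetric] algebra_simps)
    show "0 \<le> (\<Sum>i<n. b i * y i)" if "\<forall>r<n. laplacian n a y r = 0" for y
    proof -
      have "(\<Sum>i<n. b i * y i) = (\<Sum>i<n. b i * y 0)"
      proof (rule sum.cong)
        fix i assume "i \<in> {..<n}"
        then have "y i = y 0" by (intro laplacian_eq_0_imp_const[OF graph that]) auto
        then show "b i * y i = b i * y 0" by simp
      qed simp
      also have "\<dots> = 0" using balanced by (simp add: sum_distrib_right[symmetric])
      finally show ?thesis by simp
    qed
  qed (simp add: mix_closed_def)
  then obtain v where v: "\<And>y. (\<Sum>i<n. v i * laplacian n a y i) \<le> (\<Sum>i<n. b i * y i)" by blast
  let ?w = "\<lambda>i. laplacian n a v i - b i"
  have "(\<Sum>i<n. (?w i)\<^sup>2) = (\<Sum>i<n. ?w i * laplacian n a v i) - (\<Sum>i<n. b i * ?w i)"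
    by (simp add: sum_subtractf[symmetric] power2_eq_square algebra_simps)
  also have "\<dots> \<le> 0"
    using v[of ?w] laplacian_self_adjoint[OF graph(1), of v ?w] by simp
  finally have "(\<Sum>i<n. (?w i)\<^sup>2) = 0"
    by (intro antisym sum_nonneg) auto
  then have "\<forall>i<n. laplacian n a v i = b i" by (simp add: sum_nonneg_eq_0_iff)
  then show ?thesis by blast
qed

section \<open>Block inner products\<close>

definition bip :: "nat \<Rightarrow> (nat \<Rightarrow> nat) \<Rightarrow> (nat \<Rightarrow> nat \<Rightarrow> real) \<Rightarrow> (nat \<Rightarrow> nat \<Rightarrow> real) \<Rightarrow> real" where
  "bip n K u v = (\<Sum>i<n. ip (K i) (u i) (v i))"

lemma ip_diff_left: "ip q (u - v) w = ip q u w - ip q v w"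
  by (simp add: ip_def left_diff_distrib sum_subtractf)

lemma ip_diff_right: "ip q u (v - w) = ip q u v - ip q u w"
  by (simp add: ip_def right_diff_distrib sum_subtractf)

lemma ip_self_nonneg: "0 \<le> ip q u u"
  by (simp add: ip_def sum_nonneg)

lemma bip_cong:
  "(\<And>i k. i < n \<Longrightarrow> k < K i \<Longrightarrow> v i k = w i k) \<Longrightarrow> bip n K u v = bip n K u w"
  by (simp add: bip_def ip_def)

lemma bip_diff_left: "bip n K (u - v) w = bip n K u w - bip n K v w"
  by (simp add: bip_def ip_diff_left sum_subtractf)

lemma bip_diff_right: "bip n K u (v - w) = bip n K u v - bip n K u w"
  by (simp add: bip_def ip_diff_right sum_subtractf)

lemma bip_self_nonneg: "0 \<le> bip n K u u"
  by (simp add: bip_def ip_self_nonneg sum_nonneg)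

lemma bip_const_left: "bip n (\<lambda>_. m) (\<lambda>_. \<mu>) v = (\<Sum>r<m. \<mu> r * (\<Sum>i<n. v i r))"
  unfolding bip_def ip_def by (subst sum.swap) (simp add: sum_distrib_left)

lemma coordinate_power2_le_bip:
  assumes "i < n" "k < K i"
  shows "(u i k)\<^sup>2 \<le> bip n K u u"
proof -
  have "(u i k)\<^sup>2 \<le> ip (K i) (u i) (u i)"
    unfolding ip_def power2_eq_square using assms by (intro member_le_sum) auto
  also have "\<dots> \<le> bip n K u u"
    unfolding bip_def using assms by (intro member_le_sum ip_self_nonneg) auto
  finally show ?thesis .
qed

lemma lap_eq_laplacian: "r < m \<Longrightarrow> lap n m a y i r = laplacian n a (\<lambda>j. y j r) i"
  by (simp add: lap_def laplacian_def)

lemma lap_diff: "lap n m a (y - v) = lap n m a y - lap n m a v"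
  by (rule ext)+ (simp add: lap_def right_diff_distrib sum_subtractf)

lemma lap_const: "lap n m a (\<lambda>_. \<mu>) = (\<lambda>_ _. 0)"
  by (simp add: lap_def fun_eq_iff)

lemma bip_lap: "bip n (\<lambda>_. m) y (lap n m a v) = (\<Sum>r<m. \<Sum>i<n. y i r * laplacian n a (\<lambda>j. v j r) i)"
  unfolding bip_def ip_def by (subst sum.swap) (simp add: lap_eq_laplacian)

lemma bip_lap_self_adjoint:
  assumes "weighted_graph n a"
  shows "bip n (\<lambda>_. m) y (lap n m a v) = bip n (\<lambda>_. m) v (lap n m a y)"
  unfolding bip_lap by (intro sum.cong refl laplacian_self_adjoint[OF assms])

lemma bip_lap_nonneg:
  assumes "weighted_graph n a"
  shows "0 \<le> bip n (\<lambda>_. m) y (lap n m a y)"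
  unfolding bip_lap by (intro sum_nonneg laplacian_nonneg[OF assms])

lemma has_real_derivative_bip_diff_self:
  assumes "\<And>i k. i < n \<Longrightarrow> k < K i \<Longrightarrow> ((\<lambda>s. y s i k) has_real_derivative y' i k) (at t)"
  shows "((\<lambda>s. bip n K (y s - c) (y s - c) / 2) has_real_derivative bip n K (y t - c) y') (at t)"
proof -
  have "((\<lambda>s. (y s i k - c i k) * (y s i k - c i k) / 2) has_real_derivative
      (y t i k - c i k) * y' i k) (at t)"
    if "i < n" "k < K i" for i k
    by (auto intro!: derivative_eq_intros assms[OF that])
  then show ?thesis
    unfolding bip_def ip_def sum_divide_distrib by (auto intro!: DERIV_sum)
qed

lemma abs_cont_on_bip_diff_self:
  assumes "\<And>i k. i < n \<Longrightarrow> k < K i \<Longrightarrow> abs_cont_on {\<alpha>..\<beta>} (\<lambda>s. y s i k)"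
  shows "abs_cont_on {\<alpha>..\<beta>} (\<lambda>s. bip n K (y s - c) (y s - c))"
  unfolding bip_def ip_def minus_apply
  by (intro abs_cont_on_sum abs_cont_on_mult abs_cont_on_diff abs_cont_on_const assms) auto

section \<open>The topology of coordinate spaces\<close>

definition Rn_cube :: "nat \<Rightarrow> (nat \<Rightarrow> real) \<Rightarrow> real \<Rightarrow> (nat \<Rightarrow> real) set" where
  "Rn_cube q u c = {v \<in> Rn q. \<forall>k<q. \<bar>v k - u k\<bar> \<le> c}"

lemma continuous_on_coordinate [continuous_intros]:
  "continuous_on S (\<lambda>v. v k :: 'b::topological_space)"
  by (rule continuous_on_subset[OF continuous_on_product_coordinates]) simp

lemma continuous_on_block_coordinate [continuous_intros]:
  "continuous_on S (\<lambda>y. y i k :: 'b::topological_space)"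
  by (rule continuous_on_product_then_coordinatewise[OF continuous_on_coordinate])

lemma tendsto_coordinate: "(h \<longlongrightarrow> u) F \<Longrightarrow> ((\<lambda>t. h t k :: real) \<longlongrightarrow> u k) F"
  by (rule continuous_on_tendsto_compose[OF continuous_on_product_coordinates]) auto

lemma nrm_nonneg: "0 \<le> nrm q v"
  by (simp add: nrm_def ip_def sum_nonneg)

lemma nrm_power2: "(nrm q v)\<^sup>2 = ip q v v"
  by (simp add: nrm_def ip_def sum_nonneg)

lemma nrm_eq_L2_set: "nrm q v = L2_set v {..<q}"
  by (simp add: nrm_def ip_def L2_set_def power2_eq_square)

lemma nrm_le_sum_abs: "nrm q v \<le> (\<Sum>k<q. \<bar>v k\<bar>)"
  by (simp add: nrm_eq_L2_set L2_set_le_sum_abs)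

lemma abs_coordinate_le_nrm: "k < q \<Longrightarrow> \<bar>v k\<bar> \<le> nrm q v"
  using member_le_L2_set[of "{..<q}" k "\<lambda>k. \<bar>v k\<bar>"] by (simp add: nrm_eq_L2_set L2_set_def)

lemma continuous_on_nrm [continuous_intros]:
  "(\<And>k. continuous_on S (\<lambda>w. h w k)) \<Longrightarrow> continuous_on S (\<lambda>w. nrm q (h w))"
  unfolding nrm_def ip_def by (intro continuous_intros)

lemma Rn_eqI:
  assumes "u \<in> Rn q" "v \<in> Rn q" "\<And>k. k < q \<Longrightarrow> u k = v k"
  shows "u = v"
proof
  fix k show "u k = v k" using assms by (cases "k < q") (auto simp: Rn_def)
qed

lemma nrm_eq_0_imp_eq:
  assumes "u \<in> Rn q" "v \<in> Rn q" "nrm q (u - v) = 0"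
  shows "u = v"
proof (rule Rn_eqI[OF assms(1,2)])
  fix k assume "k < q"
  then show "u k = v k" using abs_coordinate_le_nrm[of k q "u - v"] assms(3) by simp
qed

lemma closed_Rn_imp_closed:
  assumes "closed_Rn q S"
  shows "closed S"
  unfolding closed_def open_subopen[of "- S"]
proof
  fix p assume "p \<in> - S"
  show "\<exists>T. open T \<and> p \<in> T \<and> T \<subseteq> - S"
  proof (cases "p \<in> Rn q")
    case True
    then obtain e where e: "e > 0" "\<forall>v\<in>Rn q. nrm q (\<lambda>k. v k - p k) < e \<longrightarrow> v \<in> Rn q - S"
      using assms \<open>p \<in> - S\<close> unfolding closed_Rn_def open_Rn_def by blast
    have "open {v. nrm q (\<lambda>k. v k - p k) < e}"
      by (intro open_Collect_less continuous_intros)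
    moreover have "p \<in> {v. nrm q (\<lambda>k. v k - p k) < e}" using e(1) by (simp add: nrm_def ip_def)
    moreover have "{v. nrm q (\<lambda>k. v k - p k) < e} \<subseteq> - S"
      using e(2) assms unfolding closed_Rn_def by blast
    ultimately show ?thesis by blast
  next
    case False
    then obtain k where "k \<ge> q" "p k \<noteq> 0" by (auto simp: Rn_def)
    moreover have "open {v :: nat \<Rightarrow> real. v k \<noteq> 0}"
      by (intro open_Collect_neq continuous_intros)
    moreover have "{v. v k \<noteq> 0} \<subseteq> - S" if "k \<ge> q" for k
      using assms that by (auto simp: closed_Rn_def Rn_def)
    ultimately show ?thesis by (intro exI[of _ "{v. v k \<noteq> 0}"]) auto
  qed
qed

lemma compact_PiE_UNIV:
  fixes S :: "'i \<Rightarrow> 'b::topological_space set"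
  assumes "\<And>i. compact (S i)"
  shows "compact (PiE UNIV S)"
  using assms compactin_PiE[of "\<lambda>_. euclidean" UNIV S]
  by (simp add: euclidean_product_topology)

lemma compact_Rn_cube: "compact (Rn_cube q u c)"
proof -
  have "Rn_cube q u c = PiE UNIV (\<lambda>k. if k < q then {u k - c..u k + c} else {0})"
    by (simp add: set_eq_iff Rn_cube_def Rn_def PiE_UNIV_domain Pi_iff abs_diff_le_iff)
       (metis not_less)
  then show ?thesis by (simp add: compact_PiE_UNIV)
qed

lemma eventually_in_Rn_cube:
  assumes "c > 0" "\<forall>\<^sub>F t in F. h t \<in> Rn q" "\<And>k. k < q \<Longrightarrow> ((\<lambda>t. h t k) \<longlongrightarrow> u k) F"
  shows "\<forall>\<^sub>F t in F. h t \<in> Rn_cube q u c"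
proof -
  have "\<forall>\<^sub>F t in F. \<forall>k\<in>{..<q}. dist (h t k) (u k) < c"
    using assms(1,3) by (intro eventually_ball_finite) (auto intro: tendstoD)
  then show ?thesis
    using assms(2) by eventually_elim (auto simp: Rn_cube_def dist_real_def intro: less_imp_le)
qed

lemma path_stays_in_Rn_cube:
  fixes y :: "'t::metric_space \<Rightarrow> nat \<Rightarrow> real"
  assumes t: "t \<in> S" and "e > 0" and y: "\<And>s. s \<in> S \<Longrightarrow> y s \<in> Rn q"
    and cont: "\<And>k. k < q \<Longrightarrow> continuous_on S (\<lambda>s. y s k)"
  obtains \<delta> where "\<delta> > 0" "\<And>s. s \<in> S \<Longrightarrow> dist s t < \<delta> \<Longrightarrow> y s \<in> Rn_cube q (y t) e"
proof -
  have "\<forall>\<^sub>F s in at t within S. y s \<in> Rn_cube q (y t) e"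
  proof (rule eventually_in_Rn_cube[OF \<open>e > 0\<close>])
    show "\<forall>\<^sub>F s in at t within S. y s \<in> Rn q"
      using y by (auto simp: eventually_at_topological)
    show "((\<lambda>s. y s k) \<longlongrightarrow> y t k) (at t within S)" if "k < q" for k
      using cont[OF that] t by (simp add: continuous_on_def)
  qed
  then obtain \<delta> where \<delta>: "\<delta> > 0" "\<And>s. s \<in> S \<Longrightarrow> s \<noteq> t \<Longrightarrow> dist s t < \<delta> \<Longrightarrow> y s \<in> Rn_cube q (y t) e"
    unfolding eventually_at by auto
  have "y s \<in> Rn_cube q (y t) e" if "s \<in> S" "dist s t < \<delta>" for s
    using \<delta>(2)[OF that(1) _ that(2)] y[OF t] \<open>e > 0\<close> by (cases "s = t") (auto simp: Rn_cube_def)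
  then show thesis using \<delta>(1) by (rule that[rotated])
qed

lemma Rn_cube_subset_nrm_ball:
  assumes "e > 0"
  obtains c where "c > 0" "\<And>v. v \<in> Rn_cube q u c \<Longrightarrow> nrm q (\<lambda>k. v k - u k) < e"
proof
  show "e / (real q + 1) > 0" using assms by simp
  fix v assume v: "v \<in> Rn_cube q u (e / (real q + 1))"
  have "nrm q (\<lambda>k. v k - u k) \<le> (\<Sum>k<q. \<bar>v k - u k\<bar>)" by (rule nrm_le_sum_abs)
  also have "\<dots> \<le> (\<Sum>k<q. e / (real q + 1))" using v by (intro sum_mono) (auto simp: Rn_cube_def)
  also have "\<dots> = real q / (real q + 1) * e" by simp
  also have "\<dots> < 1 * e" using assms by (intro mult_strict_right_mono) auto
  finally show "nrm q (\<lambda>k. v k - u k) < e" by simp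
qed

lemma interior_Rn_contains_cube:
  assumes "u \<in> interior_Rn q S"
  obtains c where "c > 0" "Rn_cube q u c \<subseteq> S"
proof -
  obtain e where e: "e > 0" "\<forall>v\<in>Rn q. nrm q (\<lambda>k. v k - u k) < e \<longrightarrow> v \<in> S"
    using assms unfolding interior_Rn_def by blast
  obtain c where "c > 0" "\<And>v. v \<in> Rn_cube q u c \<Longrightarrow> nrm q (\<lambda>k. v k - u k) < e"
    using Rn_cube_subset_nrm_ball[OF e(1)] by blast
  with e(2) show thesis by (intro that[of c]) (auto simp: Rn_cube_def)
qed

lemma open_Rn_eq_interior: "open_Rn q U \<longleftrightarrow> U \<subseteq> Rn q \<and> U = interior_Rn q U"
  unfolding open_Rn_def interior_Rn_def by blast

lemma eventually_reflection_through_interior_point: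
  assumes u: "u \<in> interior_Rn q S" "u \<in> Rn q" and v: "v \<in> Rn q"
  shows "\<forall>\<^sub>F s in at_right 0. comb (- s) u v \<in> S"
proof -
  obtain c where c: "c > 0" "Rn_cube q u c \<subseteq> S"
    using interior_Rn_contains_cube[OF u(1)] by blast
  have "comb (- s) u v \<in> Rn q" for s
    using u(2) v by (simp add: Rn_def comb_def)
  moreover have "((\<lambda>s. comb (- s) u v k) \<longlongrightarrow> (1 - - 0) * u k + - 0 * v k) (at_right 0)" for k
    unfolding comb_def by (intro tendsto_intros)
  ultimately have "\<forall>\<^sub>F s in at_right 0. comb (- s) u v \<in> Rn_cube q u c"
    using c(1) by (intro eventually_in_Rn_cube) simp_all
  then show ?thesis by eventually_elim (use c(2) in blast)
qed

section \<open>Projection onto a closed convex set\<close>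

lemma nearest_point_exists:
  assumes S: "closed_Rn q S" "S \<noteq> {}"
  shows "\<exists>p\<in>S. \<forall>w\<in>S. nrm q (y - p) \<le> nrm q (y - w)"
proof -
  obtain w0 where w0: "w0 \<in> S" using S(2) by blast
  define K where "K = S \<inter> Rn_cube q y (nrm q (y - w0))"
  have "S \<subseteq> Rn q" using S(1) by (simp add: closed_Rn_def)
  then have K: "w \<in> K" if "w \<in> S" "nrm q (y - w) \<le> nrm q (y - w0)" for w
    using that order_trans[OF abs_coordinate_le_nrm[of _ q "y - w"]]
    by (auto simp: K_def Rn_cube_def abs_minus_commute)
  have "compact K"
    unfolding K_def by (intro closed_Int_compact closed_Rn_imp_closed[OF S(1)] compact_Rn_cube)
  moreover have "K \<noteq> {}" using K w0 by blast
  moreover have "continuous_on K (\<lambda>w. nrm q (y - w))"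
    unfolding fun_diff_def by (intro continuous_intros)
  ultimately obtain p where p: "p \<in> K" "\<forall>w\<in>K. nrm q (y - p) \<le> nrm q (y - w)"
    using continuous_attains_inf by blast
  have "nrm q (y - p) \<le> nrm q (y - w)" if "w \<in> S" for w
    using p(2) K[OF that] K[OF w0] by force
  then show ?thesis using p(1) by (auto simp: K_def)
qed

lemma nearest_point_variational:
  assumes convex: "cvx_set S" and p: "p \<in> S" and w: "w \<in> S"
    and nearest: "\<And>w. w \<in> S \<Longrightarrow> nrm q (y - p) \<le> nrm q (y - w)"
  shows "ip q (y - p) (w - p) \<le> 0"
proof -
  have "2 * ip q (y - p) (w - p) \<le> \<theta> * ip q (w - p) (w - p)" if \<theta>: "0 < \<theta>" "\<theta> \<le> 1" for \<theta>
  proof -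
    have "comb \<theta> p w \<in> S" using convex p w \<theta> unfolding cvx_set_def by auto
    then have "(nrm q (y - p))\<^sup>2 \<le> (nrm q (y - comb \<theta> p w))\<^sup>2"
      by (intro power_mono nearest nrm_nonneg)
    also have "\<dots> = (nrm q (y - p))\<^sup>2 - \<theta> * (2 * ip q (y - p) (w - p))
        + \<theta> * (\<theta> * ip q (w - p) (w - p))"
      unfolding nrm_power2 ip_def comb_def
      by (simp add: sum_distrib_left sum.distrib[symmetric] sum_subtractf[symmetric] algebra_simps)
    finally have "\<theta> * (2 * ip q (y - p) (w - p)) \<le> \<theta> * (\<theta> * ip q (w - p) (w - p))" by simp
    then show ?thesis using \<theta> by simp
  qed
  then have "\<forall>\<^sub>F \<theta> in at_right 0. 2 * ip q (y - p) (w - p) \<le> \<theta> * ip q (w - p) (w - p)"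
    by (intro eventually_at_rightI[of 0 1]) auto
  moreover have "((\<lambda>\<theta>. \<theta> * ip q (w - p) (w - p)) \<longlongrightarrow> 0 * ip q (w - p) (w - p)) (at_right 0)"
    by (intro tendsto_intros)
  ultimately have "2 * ip q (y - p) (w - p) \<le> 0 * ip q (w - p) (w - p)"
    by (intro tendsto_lowerbound) auto
  then show ?thesis by simp
qed

lemma nearest_point_unique:
  assumes S: "S \<subseteq> Rn q" "cvx_set S" and p: "p \<in> S" "p' \<in> S"
    and nearest: "\<And>w. w \<in> S \<Longrightarrow> nrm q (y - p) \<le> nrm q (y - w)" "nrm q (y - p') \<le> nrm q (y - p)"
  shows "p' = p"
proof -
  have "(nrm q (y - p'))\<^sup>2 \<le> (nrm q (y - p))\<^sup>2" by (intro power_mono nearest(2) nrm_nonneg)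
  moreover have "(nrm q (y - p'))\<^sup>2 =
      (nrm q (y - p))\<^sup>2 - 2 * ip q (y - p) (p' - p) + (nrm q (p' - p))\<^sup>2"
    unfolding nrm_power2 ip_def
    by (simp add: sum_distrib_left sum.distrib[symmetric] sum_subtractf[symmetric] algebra_simps)
  moreover have "ip q (y - p) (p' - p) \<le> 0"
    by (intro nearest_point_variational[OF S(2)] p nearest(1))
  ultimately have "(nrm q (p' - p))\<^sup>2 \<le> 0" by linarith
  then show ?thesis using p S(1) by (intro nrm_eq_0_imp_eq) auto
qed

lemma
  assumes S: "closed_Rn q S" "cvx_set S" "S \<noteq> {}"
  shows proj_in_set: "proj q S y \<in> S"
    and proj_variational: "w \<in> S \<Longrightarrow> ip q (y - proj q S y) (w - proj q S y) \<le> 0"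
proof -
  let ?nearest = "\<lambda>p. p \<in> S \<and> (\<forall>w\<in>S. nrm q (y - p) \<le> nrm q (y - w))"
  have "S \<subseteq> Rn q" using S(1) by (simp add: closed_Rn_def)
  then have "\<exists>!p. ?nearest p"
    using nearest_point_exists[OF S(1,3)] nearest_point_unique[OF _ S(2)]
    by (metis (no_types, lifting))
  from theI'[OF this] have proj: "?nearest (proj q S y)" by (simp add: proj_def fun_diff_def)
  then show "proj q S y \<in> S" by blast
  show "ip q (y - proj q S y) (w - proj q S y) \<le> 0" if "w \<in> S"
    using proj that by (intro nearest_point_variational[OF S(2)]) auto
qed

section \<open>Continuity of convex functions\<close>

lemma strict_cvx_on_imp_mix_convex_on:
  assumes "strict_cvx_on q U h"
  shows "mix_convex_on comb U h"
  unfolding mix_convex_on_def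
proof (intro ballI)
  fix u v \<theta> assume uv: "u \<in> U" "v \<in> U" "\<theta> \<in> {0..1::real}"
  show "h (comb \<theta> u v) \<le> (1 - \<theta>) * h u + \<theta> * h v"
  proof (cases "u = v \<or> \<theta> = 0 \<or> \<theta> = 1")
    case True
    moreover have "comb \<theta> u u = u" "comb 0 u v = u" "comb 1 u v = v"
      by (auto simp: comb_def algebra_simps)
    ultimately show ?thesis by (auto simp: algebra_simps)
  next
    case False
    then show ?thesis using assms uv unfolding strict_cvx_on_def by (auto intro!: less_imp_le)
  qed
qed

lemma mix_convex_on_le_max_endpoints:
  assumes convex: "mix_convex_on comb U h" and a: "v(j := a) \<in> U" and b: "v(j := b) \<in> U"
    and "a < b" "a \<le> v j" "v j \<le> b"
  shows "h v \<le> max (h (v(j := a))) (h (v(j := b)))"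
proof -
  define \<theta> where "\<theta> = (v j - a) / (b - a)"
  have \<theta>: "0 \<le> \<theta>" "\<theta> \<le> 1" using assms(4-6) by (auto simp: \<theta>_def)
  have "\<theta> * (b - a) = v j - a" using assms(4) by (simp add: \<theta>_def)
  then have "comb \<theta> (v(j := a)) (v(j := b)) = v"
    by (auto simp: comb_def fun_eq_iff algebra_simps)
  then have "h v \<le> (1 - \<theta>) * h (v(j := a)) + \<theta> * h (v(j := b))"
    using mix_convex_onD[OF convex a b \<theta>] by simp
  also have "\<dots> \<le> max (h (v(j := a))) (h (v(j := b)))"
    using \<theta> by (intro convex_bound_le) auto
  finally show ?thesis .
qed

lemma mix_convex_on_le_vertex:
  assumes convex: "mix_convex_on comb U h" and "c > 0" and cube: "Rn_cube q u c \<subseteq> U"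
    and v: "v \<in> Rn_cube q u c" and "j \<le> q"
  shows "\<exists>w\<in>Rn_cube q u c. (\<forall>k<j. w k \<in> {u k - c, u k + c}) \<and> h v \<le> h w"
  using \<open>j \<le> q\<close>
proof (induction j)
  case 0
  then show ?case using v by blast
next
  case (Suc j)
  then obtain w where w: "w \<in> Rn_cube q u c" "\<forall>k<j. w k \<in> {u k - c, u k + c}" "h v \<le> h w"
    by auto
  have upd: "w(j := x) \<in> Rn_cube q u c" if "x \<in> {u j - c, u j + c}" for x
    using w(1) Suc.prems that \<open>c > 0\<close> by (auto simp: Rn_cube_def Rn_def)
  have "h w \<le> max (h (w(j := u j - c))) (h (w(j := u j + c)))"
    using w(1) upd cube \<open>c > 0\<close> Suc.prems
    by (intro mix_convex_on_le_max_endpoints[OF convex])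
       (auto simp: Rn_cube_def abs_le_iff algebra_simps)
  then obtain x where x: "x \<in> {u j - c, u j + c}" "h w \<le> h (w(j := x))"
    by (auto simp: le_max_iff_disj)
  have "\<forall>k<Suc j. (w(j := x)) k \<in> {u k - c, u k + c}"
    using w(2) x(1) by (auto simp: less_Suc_eq)
  then show ?case using upd[OF x(1)] x(2) w(3) by (meson order_trans)
qed

lemma mix_convex_on_cube_bounded_above:
  assumes convex: "mix_convex_on comb U h" and "c > 0" and cube: "Rn_cube q u c \<subseteq> U"
  shows "\<exists>M. \<forall>v\<in>Rn_cube q u c. h v \<le> M"
proof -
  define vertices where "vertices = {w \<in> Rn q. \<forall>k<q. w k \<in> {u k - c, u k + c}}"
  have "finite {w. \<forall>k. (k \<in> {..<q} \<longrightarrow> w k \<in> (\<Union>k<q. {u k - c, u k + c})) \<and> (k \<notin> {..<q} \<longrightarrow> w k = 0)}"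
    by (intro finite_set_of_finite_funs) auto
  then have "finite vertices"
    by (rule rev_finite_subset) (auto simp: vertices_def Rn_def)
  have "h v \<le> Max (h ` vertices)" if "v \<in> Rn_cube q u c" for v
  proof -
    from mix_convex_on_le_vertex[OF convex \<open>c > 0\<close> cube that order_refl]
    obtain w where "w \<in> Rn_cube q u c" "\<forall>k<q. w k \<in> {u k - c, u k + c}" "h v \<le> h w"
      by blast
    then have "w \<in> vertices" "h v \<le> h w" by (auto simp: vertices_def Rn_cube_def)
    then show ?thesis using \<open>finite vertices\<close> by (meson Max_ge finite_imageI imageI order_trans)
  qed
  then show ?thesis by blast
qed

lemma mix_convex_on_cube_oscillation:
  assumes convex: "mix_convex_on comb U h" and "c > 0" and cube: "Rn_cube q u c \<subseteq> U" and u: "u \<in> Rn q"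
  shows "\<exists>K\<ge>0. \<forall>v\<in>Rn_cube q u c. \<forall>w\<in>Rn_cube q u c. h w - h v \<le> K"
proof -
  obtain M where M: "\<forall>v\<in>Rn_cube q u c. h v \<le> M"
    using mix_convex_on_cube_bounded_above[OF assms(1-3)] by blast
  have lower: "2 * h u - M \<le> h v" if v: "v \<in> Rn_cube q u c" for v
  proof -
    define v' where "v' k = 2 * u k - v k" for k
    have v': "v' \<in> Rn_cube q u c"
      using v u by (auto simp: v'_def Rn_cube_def Rn_def abs_minus_commute)
    have "comb (1/2) v v' = u" by (auto simp: comb_def v'_def fun_eq_iff field_simps)
    then have "h u \<le> (1 - 1/2) * h v + 1/2 * h v'"
      using mix_convex_onD[OF convex, of v v' "1/2"] v v' cube by auto
    also have "\<dots> \<le> (1 - 1/2) * h v + 1/2 * M" using M v' by simp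
    finally show ?thesis by (simp add: field_simps)
  qed
  have "h w - h v \<le> 2 * (M - h u)" if "v \<in> Rn_cube q u c" "w \<in> Rn_cube q u c" for v w
    using M lower[OF that(1)] that(2) by force
  moreover have "h u \<le> M" using M u \<open>c > 0\<close> by (simp add: Rn_cube_def)
  ultimately show ?thesis by (intro exI[of _ "2 * (M - h u)"]) auto
qed

lemma Rn_cube_extrapolate:
  assumes "c > 0" and v: "v \<in> Rn_cube q u (c / 2)" and w: "w \<in> Rn_cube q u (c / 2)" and "v \<noteq> w"
    and s: "s = (\<Sum>k<q. \<bar>v k - w k\<bar>)"
  obtains w' where "s > 0" "w' \<in> Rn_cube q u c" "comb (2 * s / (2 * s + c)) v w' = w"
proof
  have le_s: "\<bar>v k - w k\<bar> \<le> s" if "k < q" for k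
    unfolding s using that by (intro member_le_sum) auto
  show "s > 0"
  proof (rule ccontr)
    assume "\<not> s > 0"
    then have "v = w" using v w le_s by (intro Rn_eqI[of v q]) (force simp: Rn_cube_def)+
    then show False using \<open>v \<noteq> w\<close> by simp
  qed
  define w' where "w' k = w k + c / (2 * s) * (w k - v k)" for k
  show "w' \<in> Rn_cube q u c"
    unfolding Rn_cube_def
  proof (intro CollectI conjI allI impI)
    show "w' \<in> Rn q" using v w by (auto simp: w'_def Rn_cube_def Rn_def)
    fix k assume k: "k < q"
    have "\<bar>c / (2 * s) * (w k - v k)\<bar> = c / (2 * s) * \<bar>v k - w k\<bar>"
      using \<open>c > 0\<close> \<open>s > 0\<close> by (simp add: abs_mult abs_minus_commute)
    also have "\<dots> \<le> c / (2 * s) * s" using le_s[OF k] \<open>c > 0\<close> \<open>s > 0\<close> by (intro mult_left_mono) auto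
    also have "\<dots> = c / 2" using \<open>s > 0\<close> by simp
    finally have "\<bar>c / (2 * s) * (w k - v k)\<bar> \<le> c / 2" .
    moreover have "\<bar>w k - u k\<bar> \<le> c / 2" using w k by (simp add: Rn_cube_def)
    ultimately show "\<bar>w' k - u k\<bar> \<le> c" unfolding w'_def by linarith
  qed
  define \<theta> where "\<theta> = 2 * s / (2 * s + c)"
  have "1 + c / (2 * s) = (2 * s + c) / (2 * s)" using \<open>s > 0\<close> by (simp add: add_divide_distrib)
  then have \<theta>: "\<theta> * (1 + c / (2 * s)) = 1" using \<open>c > 0\<close> \<open>s > 0\<close> by (simp add: \<theta>_def)
  have "comb \<theta> v w' k = v k + \<theta> * (1 + c / (2 * s)) * (w k - v k)" for k
    by (simp add: comb_def w'_def algebra_simps)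
  then show "comb (2 * s / (2 * s + c)) v w' = w"
    unfolding \<theta> by (simp add: fun_eq_iff \<theta>_def)
qed

text \<open>Continuing the segment from \<open>v\<close> through \<open>w\<close> by a length comparable to \<open>c\<close> keeps it in the
  larger cube, where convexity bounds the slope by the oscillation.\<close>

lemma mix_convex_on_half_cube_diff_le:
  assumes convex: "mix_convex_on comb U h" and "c > 0" and cube: "Rn_cube q u c \<subseteq> U"
    and oscillation: "K \<ge> 0" "\<And>v w. v \<in> Rn_cube q u c \<Longrightarrow> w \<in> Rn_cube q u c \<Longrightarrow> h w - h v \<le> K"
    and v: "v \<in> Rn_cube q u (c / 2)" and w: "w \<in> Rn_cube q u (c / 2)"
  shows "h w - h v \<le> 2 * K / c * (\<Sum>k<q. \<bar>v k - w k\<bar>)"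
proof (cases "v = w")
  case False
  define s where "s = (\<Sum>k<q. \<bar>v k - w k\<bar>)"
  define \<theta> where "\<theta> = 2 * s / (2 * s + c)"
  obtain w' where "s > 0" and w': "w' \<in> Rn_cube q u c" "comb \<theta> v w' = w"
    using Rn_cube_extrapolate[OF \<open>c > 0\<close> v w False s_def] unfolding \<theta>_def by blast
  have v': "v \<in> Rn_cube q u c"
    using v \<open>c > 0\<close> order_trans[of _ "c / 2" c] by (auto simp: Rn_cube_def)
  have \<theta>: "0 \<le> \<theta>" "\<theta> \<le> 1" using \<open>c > 0\<close> \<open>s > 0\<close> by (auto simp: \<theta>_def)
  then have "h w \<le> (1 - \<theta>) * h v + \<theta> * h w'"
    using mix_convex_onD[OF convex, of v w' \<theta>] cube v' w' by auto
  then have "h w - h v \<le> \<theta> * (h w' - h v)" by (simp add: algebra_simps)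
  also have "\<dots> \<le> \<theta> * K" using oscillation(2)[OF v' w'(1)] \<theta> by (intro mult_left_mono) auto
  also have "\<dots> \<le> 2 * s / c * K"
    unfolding \<theta>_def using oscillation(1) \<open>c > 0\<close> \<open>s > 0\<close> by (intro mult_right_mono divide_left_mono) auto
  finally show ?thesis by (simp add: s_def mult.commute)
qed simp

lemma mix_convex_on_locally_Lipschitz:
  assumes convex: "mix_convex_on comb U h" and open_U: "open_Rn q U" and u: "u \<in> U"
  obtains e M where "e > 0" "\<And>v w. v \<in> Rn_cube q u e \<Longrightarrow> w \<in> Rn_cube q u e \<Longrightarrow>
    \<bar>h v - h w\<bar> \<le> M * (\<Sum>k<q. \<bar>v k - w k\<bar>)"
proof -
  have "u \<in> interior_Rn q U" "u \<in> Rn q" using open_U u open_Rn_eq_interior by blast+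
  then obtain c where c: "c > 0" "Rn_cube q u c \<subseteq> U"
    using interior_Rn_contains_cube by blast
  obtain K where oscillation: "K \<ge> 0" "\<And>v w. v \<in> Rn_cube q u c \<Longrightarrow> w \<in> Rn_cube q u c \<Longrightarrow> h w - h v \<le> K"
    using mix_convex_on_cube_oscillation[OF convex c \<open>u \<in> Rn q\<close>] by blast
  have "\<bar>h v - h w\<bar> \<le> 2 * K / c * (\<Sum>k<q. \<bar>v k - w k\<bar>)"
    if "v \<in> Rn_cube q u (c / 2)" "w \<in> Rn_cube q u (c / 2)" for v w
    using mix_convex_on_half_cube_diff_le[OF convex c oscillation that]
      mix_convex_on_half_cube_diff_le[OF convex c oscillation that(2,1)]
    by (simp add: abs_le_iff abs_minus_commute)
  then show thesis using c(1) by (intro that[of "c / 2" "2 * K / c"]) simp_all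
qed

lemma mix_convex_on_imp_continuous_on:
  assumes convex: "mix_convex_on comb U h" and open_U: "open_Rn q U"
  shows "continuous_on U h"
  unfolding continuous_on_def
proof
  fix u assume u: "u \<in> U"
  obtain e M where e: "e > 0" and Lipschitz: "\<And>v w. v \<in> Rn_cube q u e \<Longrightarrow> w \<in> Rn_cube q u e \<Longrightarrow>
      \<bar>h v - h w\<bar> \<le> M * (\<Sum>k<q. \<bar>v k - w k\<bar>)"
    using mix_convex_on_locally_Lipschitz[OF convex open_U u] by blast
  have U_subset_Rn: "U \<subseteq> Rn q" using open_U by (simp add: open_Rn_def)
  then have u': "u \<in> Rn_cube q u e" using u e by (auto simp: Rn_cube_def)
  have coord: "((\<lambda>v. v k) \<longlongrightarrow> u k) (at u within U)" for k
    by (intro tendsto_coordinate) simp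
  have "\<forall>\<^sub>F v in at u within U. v \<in> Rn q"
    using U_subset_Rn by (auto simp: eventually_at_topological)
  then have "\<forall>\<^sub>F v in at u within U. v \<in> Rn_cube q u e"
    by (intro eventually_in_Rn_cube e coord)
  then have "\<forall>\<^sub>F v in at u within U. norm (h v - h u) \<le> M * (\<Sum>k<q. \<bar>v k - u k\<bar>)"
    by eventually_elim (use Lipschitz u' in auto)
  moreover have "((\<lambda>v. M * (\<Sum>k<q. \<bar>v k - u k\<bar>)) \<longlongrightarrow> M * (\<Sum>k<q. \<bar>u k - u k\<bar>)) (at u within U)"
    by (intro tendsto_intros coord)
  then have "((\<lambda>v. M * (\<Sum>k<q. \<bar>v k - u k\<bar>)) \<longlongrightarrow> 0) (at u within U)" by simp
  ultimately have "((\<lambda>v. h v - h u) \<longlongrightarrow> 0) (at u within U)"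
    by (rule Lim_null_comparison)
  then show "(h \<longlongrightarrow> h u) (at u within U)" by (simp add: LIM_zero_iff)
qed

text \<open>A convex function is only locally Lipschitz on its open domain, so absolute continuity is
  obtained locally and then glued.\<close>

lemma abs_cont_on_mix_convex_compose:
  assumes convex: "mix_convex_on comb U h" and open_U: "open_Rn q U" and "\<alpha> \<le> \<beta>"
    and y: "\<And>t. t \<in> {\<alpha>..\<beta>} \<Longrightarrow> y t \<in> U" "\<And>k. k < q \<Longrightarrow> abs_cont_on {\<alpha>..\<beta>} (\<lambda>t. y t k)"
  shows "abs_cont_on {\<alpha>..\<beta>} (\<lambda>t. h (y t))"
proof (rule abs_cont_on_localI[OF \<open>\<alpha> \<le> \<beta>\<close>])
  fix t assume "\<alpha> \<le> t" "t \<le> \<beta>"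
  then have t: "t \<in> {\<alpha>..\<beta>}" by simp
  obtain e M where e: "e > 0" and Lipschitz: "\<And>v w. v \<in> Rn_cube q (y t) e \<Longrightarrow> w \<in> Rn_cube q (y t) e \<Longrightarrow>
      \<bar>h v - h w\<bar> \<le> M * (\<Sum>k<q. \<bar>v k - w k\<bar>)"
    using mix_convex_on_locally_Lipschitz[OF convex open_U y(1)[OF t]] by blast
  have "y s \<in> Rn q" if "s \<in> {\<alpha>..\<beta>}" for s
    using y(1)[OF that] open_U by (auto simp: open_Rn_def)
  then obtain \<delta> where "\<delta> > 0"
    and near: "\<And>s. s \<in> {\<alpha>..\<beta>} \<Longrightarrow> dist s t < \<delta> \<Longrightarrow> y s \<in> Rn_cube q (y t) e"
    using path_stays_in_Rn_cube[OF t e, of y q] abs_cont_on_imp_continuous_on[OF y(2)] by blast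
  have "abs_cont_on {\<alpha>'..\<beta>'} (\<lambda>t. h (y t))"
    if ab: "\<alpha> \<le> \<alpha>'" "\<alpha>' \<le> t" "t \<le> \<beta>'" "\<beta>' \<le> \<beta>" "\<beta>' - \<alpha>' < \<delta>" for \<alpha>' \<beta>'
  proof (rule abs_cont_on_dominated[where I = "{..<q}" and y = "\<lambda>k s. y s k" and M = M])
    show "\<bar>h (y s) - h (y s')\<bar> \<le> M * (\<Sum>k<q. \<bar>y s k - y s' k\<bar>)"
      if "s \<in> {\<alpha>'..\<beta>'}" "s' \<in> {\<alpha>'..\<beta>'}" for s s'
      using that ab by (intro Lipschitz near) (auto simp: dist_real_def)
    show "abs_cont_on {\<alpha>'..\<beta>'} (\<lambda>s. y s k)" if "k \<in> {..<q}" for k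
      using that ab by (intro abs_cont_on_subset[OF y(2)]) auto
  qed simp
  then show "\<exists>d>0. \<forall>\<alpha>' \<beta>'. \<alpha> \<le> \<alpha>' \<and> \<alpha>' \<le> t \<and> t \<le> \<beta>' \<and> \<beta>' \<le> \<beta> \<and> \<beta>' - \<alpha>' < d \<longrightarrow>
      abs_cont_on {\<alpha>'..\<beta>'} (\<lambda>t. h (y t))"
    using \<open>\<delta> > 0\<close> by blast
qed

section \<open>The resource allocation problem\<close>

lemma comb2_eq_comb: "comb2 \<theta> u v i = comb \<theta> (u i) (v i)"
  by (simp add: comb2_def comb_def)

lemma Wmul_comb:
  "Wmul m qi Wi (comb \<theta> u v) r = (1 - \<theta>) * Wmul m qi Wi u r + \<theta> * Wmul m qi Wi v r"
  by (simp add: Wmul_def comb_def sum_distrib_left sum.distrib[symmetric] algebra_simps)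

lemma ip_Wmul_adjoint: "ip m l (Wmul m qi Wi v) = ip qi (WTmul m qi Wi l) v"
proof -
  have "ip m l (Wmul m qi Wi v) = (\<Sum>r<m. \<Sum>k<qi. l r * (Wi r k * v k))"
    by (simp add: ip_def Wmul_def sum_distrib_left)
  also have "\<dots> = (\<Sum>k<qi. \<Sum>r<m. l r * (Wi r k * v k))" by (rule sum.swap)
  also have "\<dots> = ip qi (WTmul m qi Wi l) v"
    unfolding ip_def
    by (intro sum.cong refl) (simp add: WTmul_def sum_distrib_left mult.left_commute mult.commute)
  finally show ?thesis .
qed

lemma Xset_eqI:
  assumes "u \<in> Xset n S" "v \<in> Xset n S" "\<And>i. i < n \<Longrightarrow> u i = v i"
  shows "u = v"
proof
  fix i show "u i = v i" using assms by (cases "i < n") (auto simp: Xset_def)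
qed

locale resource_allocation =
  fixes n m :: nat and q :: "nat \<Rightarrow> nat" and a :: "nat \<Rightarrow> nat \<Rightarrow> real"
    and Om U :: "nat \<Rightarrow> (nat \<Rightarrow> real) set" and f :: "nat \<Rightarrow> (nat \<Rightarrow> real) \<Rightarrow> real"
    and W :: "nat \<Rightarrow> nat \<Rightarrow> nat \<Rightarrow> real" and d :: "nat \<Rightarrow> nat \<Rightarrow> real"
  assumes graph: "weighted_graph n a" and connected: "graph_connected n a"
    and Om_closed: "\<And>i. i < n \<Longrightarrow> closed_Rn (q i) (Om i)"
    and Om_convex: "\<And>i. i < n \<Longrightarrow> cvx_set (Om i)"
    and U_open: "\<And>i. i < n \<Longrightarrow> open_Rn (q i) (U i)"
    and Om_subset_U: "\<And>i. i < n \<Longrightarrow> Om i \<subseteq> U i"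
    and f_strict: "\<And>i. i < n \<Longrightarrow> strict_cvx_on (q i) (U i) (f i)"
    and slater: "\<exists>x. (\<forall>i<n. x i \<in> interior_Rn (q i) (Om i)) \<and> (\<forall>i\<ge>n. x i = (\<lambda>_. 0)) \<and>
      (\<forall>r<m. (\<Sum>i<n. Wmul m (q i) (W i) (x i) r) = (\<Sum>i<n. d i r))"
begin

definition Wbar :: "(nat \<Rightarrow> nat \<Rightarrow> real) \<Rightarrow> nat \<Rightarrow> nat \<Rightarrow> real" where
  "Wbar y = (\<lambda>i. Wmul m (q i) (W i) (y i))"

definition residual :: "(nat \<Rightarrow> nat \<Rightarrow> real) \<Rightarrow> nat \<Rightarrow> real" where
  "residual y r = (\<Sum>i<n. Wbar y i r) - (\<Sum>i<n. d i r)"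

definition cost :: "(nat \<Rightarrow> nat \<Rightarrow> real) \<Rightarrow> real" where
  "cost y = (\<Sum>i<n. f i (y i))"

lemma Om_subset_Rn: "i < n \<Longrightarrow> Om i \<subseteq> Rn (q i)"
  using Om_closed by (auto simp: closed_Rn_def)

lemma component_in_Om: "y \<in> Xset n Om \<Longrightarrow> i < n \<Longrightarrow> y i \<in> Om i"
  by (simp add: Xset_def)

lemma component_in_U: "y \<in> Xset n Om \<Longrightarrow> i < n \<Longrightarrow> y i \<in> U i"
  using component_in_Om Om_subset_U by blast

lemma f_convex: "i < n \<Longrightarrow> mix_convex_on comb (U i) (f i)"
  using strict_cvx_on_imp_mix_convex_on f_strict by blast

lemma feasible_iff: "feasible n m q Om W d y \<longleftrightarrow> y \<in> Xset n Om \<and> (\<forall>r<m. residual y r = 0)"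
  by (simp add: feasible_def residual_def Wbar_def)

lemma mix_closed_Xset: "mix_closed comb2 (Xset n Om)"
  unfolding mix_closed_def
proof (intro ballI)
  fix u v \<theta> assume uv: "u \<in> Xset n Om" "v \<in> Xset n Om" and \<theta>: "\<theta> \<in> {0..1::real}"
  have "comb2 \<theta> u v i \<in> Om i" if "i < n" for i
    using Om_convex[OF that] component_in_Om[OF uv(1) that] component_in_Om[OF uv(2) that] \<theta>
    by (simp add: comb2_eq_comb cvx_set_def)
  then show "comb2 \<theta> u v \<in> Xset n Om" using uv by (simp add: Xset_def comb2_def)
qed

lemma residual_comb2: "residual (comb2 \<theta> u v) r = (1 - \<theta>) * residual u r + \<theta> * residual v r"
proof -
  have "(\<Sum>i<n. Wbar (comb2 \<theta> u v) i r) = (1 - \<theta>) * (\<Sum>i<n. Wbar u i r) + \<theta> * (\<Sum>i<n. Wbar v i r)"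
    by (simp add: Wbar_def comb2_eq_comb Wmul_comb sum.distrib sum_distrib_left)
  then show ?thesis by (simp add: residual_def algebra_simps)
qed

lemma cost_mix_convex: "mix_convex_on comb2 (Xset n Om) cost"
  unfolding mix_convex_on_def
proof (intro ballI)
  fix u v \<theta> assume uv: "u \<in> Xset n Om" "v \<in> Xset n Om" and \<theta>: "\<theta> \<in> {0..1::real}"
  have "cost (comb2 \<theta> u v) \<le> (\<Sum>i<n. (1 - \<theta>) * f i (u i) + \<theta> * f i (v i))"
    unfolding cost_def comb2_eq_comb using uv \<theta>
    by (intro sum_mono mix_convex_onD[OF f_convex]) (auto intro: component_in_U)
  then show "cost (comb2 \<theta> u v) \<le> (1 - \<theta>) * cost u + \<theta> * cost v"
    by (simp add: cost_def sum.distrib sum_distrib_left)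
qed

lemma cost_strictly_convex:
  assumes uv: "u \<in> Xset n Om" "v \<in> Xset n Om" "u \<noteq> v" and \<theta>: "0 < \<theta>" "\<theta> < 1"
  shows "cost (comb2 \<theta> u v) < (1 - \<theta>) * cost u + \<theta> * cost v"
proof -
  obtain i where i: "i < n" "u i \<noteq> v i" using Xset_eqI[OF uv(1,2)] uv(3) by blast
  have "cost (comb2 \<theta> u v) < (\<Sum>i<n. (1 - \<theta>) * f i (u i) + \<theta> * f i (v i))"
    unfolding cost_def comb2_eq_comb
  proof (rule sum_strict_mono_ex1)
    show "\<forall>i\<in>{..<n}. f i (comb \<theta> (u i) (v i)) \<le> (1 - \<theta>) * f i (u i) + \<theta> * f i (v i)"
      using uv \<theta> by (auto intro!: mix_convex_onD[OF f_convex] component_in_U)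
    show "\<exists>i\<in>{..<n}. f i (comb \<theta> (u i) (v i)) < (1 - \<theta>) * f i (u i) + \<theta> * f i (v i)"
      using f_strict[OF i(1)] component_in_U[OF uv(1) i(1)] component_in_U[OF uv(2) i(1)] i \<theta>
      unfolding strict_cvx_on_def by blast
  qed simp
  then show ?thesis by (simp add: cost_def sum.distrib sum_distrib_left)
qed

lemma Slater_point_reflects:
  assumes y: "y \<in> Xset n Om"
  shows "\<exists>y'\<in>Xset n Om. \<exists>s>0. \<forall>r<m. residual y' r = - s * residual y r"
proof -
  obtain x where x: "\<And>i. i < n \<Longrightarrow> x i \<in> interior_Rn (q i) (Om i)" "\<And>i. i \<ge> n \<Longrightarrow> x i = (\<lambda>_. 0)"
    and "\<And>r. r < m \<Longrightarrow> (\<Sum>i<n. Wmul m (q i) (W i) (x i) r) = (\<Sum>i<n. d i r)"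
    using slater by blast
  then have x_residual: "residual x r = 0" if "r < m" for r
    using that by (simp add: residual_def Wbar_def)
  have "\<forall>\<^sub>F s in at_right 0. comb (- s) (x i) (y i) \<in> Om i" if i: "i < n" for i
    using x(1)[OF i] component_in_Om[OF y i] Om_subset_Rn[OF i]
    by (intro eventually_reflection_through_interior_point) (auto simp: interior_Rn_def)
  then have "\<forall>\<^sub>F s in at_right 0. (\<forall>i\<in>{..<n}. comb (- s) (x i) (y i) \<in> Om i) \<and> 0 < s"
    by (intro eventually_conj eventually_ball_finite eventually_at_right_less) auto
  then obtain s :: real where s: "\<forall>i\<in>{..<n}. comb (- s) (x i) (y i) \<in> Om i" "s > 0"
    using eventually_happens trivial_limit_at_right_real by blast
  have "comb2 (- s) x y \<in> Xset n Om"
    using s(1) x(2) y by (auto simp: Xset_def comb2_eq_comb comb_def)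
  moreover have "\<forall>r<m. residual (comb2 (- s) x y) r = - s * residual y r"
    by (simp add: residual_comb2 x_residual)
  ultimately show ?thesis using s(2) by blast
qed

lemma Lagrange_multiplier_exists:
  assumes "is_optimal n m q Om f W d xs"
  shows "\<exists>\<mu>. \<forall>y\<in>Xset n Om. (\<Sum>r<m. \<mu> r * residual y r) \<le> cost y - cost xs"
proof (rule affine_multipliers[OF mix_closed_Xset])
  show "mix_convex_on comb2 (Xset n Om) (\<lambda>y. cost y - cost xs)"
    using cost_mix_convex by (simp add: mix_convex_on_def algebra_simps)
  show "mix_affine_on comb2 (Xset n Om) (\<lambda>y. residual y r)" for r
    by (simp add: mix_affine_on_def residual_comb2)
  show "0 \<le> cost y - cost xs" if "y \<in> Xset n Om" "\<forall>r<m. residual y r = 0" for y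
    using assms that by (simp add: is_optimal_def feasible_iff cost_def)
qed (rule Slater_point_reflects)

lemma residual_potential_exists:
  assumes "feasible n m q Om W d xs"
  shows "\<exists>zs. \<forall>i<n. \<forall>r<m. lap n m a zs i r = d i r - Wbar xs i r"
proof -
  have "\<exists>v. \<forall>i<n. laplacian n a v i = d i r - Wbar xs i r" if "r < m" for r
    using assms that
    by (intro laplacian_solvable graph connected) (simp add: feasible_iff residual_def sum_subtractf)
  then obtain Z where "\<And>r i. r < m \<Longrightarrow> i < n \<Longrightarrow> laplacian n a (Z r) i = d i r - Wbar xs i r"
    by metis
  then show ?thesis by (intro exI[of _ "\<lambda>i r. Z r i"]) (simp add: lap_eq_laplacian)
qed

lemma cost_subgradient:
  assumes g: "\<And>i. i < n \<Longrightarrow> g i \<in> subgrad (q i) (U i) (f i) (y i)" and v: "v \<in> Xset n Om"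
  shows "cost y + (bip n q g v - bip n q g y) \<le> cost v"
proof -
  have "(\<Sum>i<n. f i (y i) + ip (q i) (g i) (v i - y i)) \<le> cost v"
    unfolding cost_def using g component_in_U[OF v]
    by (intro sum_mono) (auto simp: subgrad_def fun_diff_def)
  then show ?thesis
    by (simp add: cost_def bip_def ip_diff_right sum.distrib sum_subtractf)
qed

lemma FmapE:
  assumes "(p, u, w) \<in> Fmap n m q a Om U f W d X L Z"
  obtains g where "\<forall>i<n. g i \<in> subgrad (q i) (U i) (f i) (X i)"
    and "\<forall>i<n. \<forall>k<q i.
      p i k = proj (q i) (Om i) (\<lambda>k'. X i k' - g i k' + WTmul m (q i) (W i) (L i) k') k - X i k"
    and "\<forall>i<n. \<forall>r<m. u i r = d i r - Wbar X i r - lap n m a L i r - lap n m a Z i r - Wbar p i r"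
    and "\<forall>i<n. w i = lap n m a L i"
  using assms unfolding Fmap_def Wbar_def by auto

lemma compact_bounded_Xset: "compact {y \<in> Xset n Om. \<forall>i<n. \<forall>k<q i. \<bar>y i k\<bar> \<le> B}"
proof -
  define S where "S i = (if i < n then Om i \<inter> Rn_cube (q i) (\<lambda>_. 0) B else {\<lambda>_. 0})" for i
  have inside: "v \<in> S i \<longleftrightarrow> v \<in> Om i \<and> (\<forall>k<q i. \<bar>v k\<bar> \<le> B)" if "i < n" for v i
    using Om_subset_Rn[OF that] that by (auto simp: S_def Rn_cube_def)
  have outside: "v \<in> S i \<longleftrightarrow> v = (\<lambda>_. 0)" if "i \<ge> n" for v i
    using that by (simp add: S_def)
  have split: "(\<forall>i. y i \<in> S i) \<longleftrightarrow> (\<forall>i<n. y i \<in> S i) \<and> (\<forall>i\<ge>n. y i \<in> S i)" for y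
    by (meson not_less)
  have "{y \<in> Xset n Om. \<forall>i<n. \<forall>k<q i. \<bar>y i k\<bar> \<le> B} = {y. \<forall>i. y i \<in> S i}"
    by (auto simp: split inside outside Xset_def)
  also have "\<dots> = PiE UNIV S" by (auto simp: PiE_UNIV_domain)
  finally show ?thesis
    using Om_closed
    by (auto simp: S_def
        intro!: compact_PiE_UNIV closed_Int_compact closed_Rn_imp_closed compact_Rn_cube)
qed

lemma continuous_on_cost: "continuous_on (Xset n Om) cost"
  unfolding cost_def
proof (intro continuous_on_sum)
  fix i assume "i \<in> {..<n}"
  then have i: "i < n" by simp
  show "continuous_on (Xset n Om) (\<lambda>y. f i (y i))"
    using component_in_U[OF _ i]
    by (intro continuous_on_coordinate
        continuous_on_compose2[OF mix_convex_on_imp_continuous_on[OF f_convex[OF i] U_open[OF i]]]) auto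
qed

lemma continuous_on_residual: "continuous_on S (\<lambda>y. residual y r)"
  unfolding residual_def Wbar_def Wmul_def
  by (cases "r < m") (simp_all add: continuous_intros)

end

section \<open>The Lagrangian gap at a saddle point\<close>

locale saddle_point = resource_allocation +
  fixes xs :: "nat \<Rightarrow> nat \<Rightarrow> real" and \<mu> :: "nat \<Rightarrow> real" and zs :: "nat \<Rightarrow> nat \<Rightarrow> real"
  assumes feasible: "feasible n m q Om W d xs"
    and multiplier: "\<And>y. y \<in> Xset n Om \<Longrightarrow> (\<Sum>r<m. \<mu> r * residual y r) \<le> cost y - cost xs"
    and potential: "\<And>i r. i < n \<Longrightarrow> r < m \<Longrightarrow> lap n m a zs i r = d i r - Wbar xs i r"
begin

definition gap :: "(nat \<Rightarrow> nat \<Rightarrow> real) \<Rightarrow> real" where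
  "gap y = cost y - cost xs - (\<Sum>r<m. \<mu> r * residual y r)"

lemma xs_Xset: "xs \<in> Xset n Om"
  using feasible by (simp add: feasible_iff)

lemma residual_xs: "r < m \<Longrightarrow> residual xs r = 0"
  using feasible by (simp add: feasible_iff)

lemma gap_nonneg: "y \<in> Xset n Om \<Longrightarrow> 0 \<le> gap y"
  using multiplier by (simp add: gap_def)

lemma gap_pos:
  assumes y: "y \<in> Xset n Om" and "y \<noteq> xs"
  shows "0 < gap y"
proof -
  let ?v = "comb2 (1/2) y xs"
  have "?v \<in> Xset n Om" using mix_closed_Xset y xs_Xset by (simp add: mix_closed_def)
  then have "0 \<le> gap ?v" by (rule gap_nonneg)
  also have "gap ?v < gap y / 2"
  proof -
    have "cost ?v < (1 - 1/2) * cost y + 1/2 * cost xs"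
      using assms xs_Xset by (intro cost_strictly_convex) auto
    moreover have "(\<Sum>r<m. \<mu> r * residual ?v r) = (\<Sum>r<m. \<mu> r * residual y r) / 2"
      unfolding sum_divide_distrib by (intro sum.cong) (simp_all add: residual_comb2 residual_xs)
    ultimately show ?thesis by (simp add: gap_def field_simps)
  qed
  finally show ?thesis by simp
qed

lemma continuous_on_gap: "continuous_on (Xset n Om) gap"
  unfolding gap_def by (intro continuous_intros continuous_on_cost continuous_on_residual)

lemma gap_bounded_below:
  assumes "\<epsilon> > 0"
  obtains c where "c > 0" "\<And>y. y \<in> Xset n Om \<Longrightarrow> \<forall>i<n. \<forall>k<q i. \<bar>y i k\<bar> \<le> B \<Longrightarrow>
    \<epsilon> \<le> \<bar>y i k - xs i k\<bar> \<Longrightarrow> c \<le> gap y"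
proof -
  define K where "K = {y. \<epsilon> \<le> \<bar>y i k - xs i k\<bar>} \<inter> {y \<in> Xset n Om. \<forall>i<n. \<forall>k<q i. \<bar>y i k\<bar> \<le> B}"
  have "closed {y. \<epsilon> \<le> \<bar>y i k - xs i k\<bar>}"
    by (intro closed_Collect_le continuous_intros)
  then have "compact K"
    unfolding K_def by (intro closed_Int_compact compact_bounded_Xset)
  moreover have "continuous_on K gap"
    by (rule continuous_on_subset[OF continuous_on_gap]) (auto simp: K_def)
  moreover have "0 < gap y" if "y \<in> K" for y
    using that \<open>\<epsilon> > 0\<close> by (intro gap_pos) (auto simp: K_def)
  ultimately have "\<exists>c>0. \<forall>y\<in>K. c \<le> gap y"
    using continuous_attains_inf[of K gap] by (cases "K = {}") (auto intro: exI[of _ 1])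
  then show thesis using that by (auto simp: K_def)
qed

section \<open>Dissipation inequality\<close>

lemma projection_step_inequality:
  assumes i: "i < n" and X: "X \<in> Om i" and g: "g \<in> subgrad (q i) (U i) (f i) X"
    and p: "\<And>k. k < q i \<Longrightarrow>
      p k = proj (q i) (Om i) (\<lambda>k'. X k' - g k' + WTmul m (q i) (W i) l k') k - X k"
  shows "ip (q i) g p + ip (q i) (X - xs i) p + ip (q i) p p + (f i X - f i (xs i))
    \<le> ip m l (Wmul m (q i) (W i) X - Wmul m (q i) (W i) (xs i)) + ip m l (Wmul m (q i) (W i) p)"
proof -
  let ?\<omega> = "WTmul m (q i) (W i) l"
  define y where "y k = X k - g k + ?\<omega> k" for k
  define P where "P = proj (q i) (Om i) y"
  have xs: "xs i \<in> Om i" by (rule component_in_Om[OF xs_Xset i])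
  have P: "P k = X k + p k" if "k < q i" for k
    using p[OF that] by (simp add: P_def y_def[abs_def])
  have "ip (q i) (y - P) (xs i - P) \<le> 0"
    unfolding P_def using X xs by (intro proj_variational Om_closed Om_convex i) auto
  also have "ip (q i) (y - P) (xs i - P) = (\<Sum>k<q i. (?\<omega> k - g k - p k) * (xs i k - X k - p k))"
    unfolding ip_def by (intro sum.cong refl) (simp add: y_def P diff_diff_eq add.commute)
  also have "\<dots> = ip (q i) g p + ip (q i) (X - xs i) p + ip (q i) p p
      - ip (q i) g (xs i - X) - ip (q i) ?\<omega> (X - xs i) - ip (q i) ?\<omega> p"
    unfolding ip_def
    by (simp add: sum.distrib[symmetric] sum_subtractf[symmetric] algebra_simps)
  finally have variational: "\<dots> \<le> 0" .
  have "f i X + ip (q i) g (xs i - X) \<le> f i (xs i)"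
    using g Om_subset_U[OF i] xs by (auto simp: subgrad_def fun_diff_def)
  with variational show ?thesis
    unfolding ip_diff_right ip_Wmul_adjoint by linarith
qed

lemma dual_dissipation:
  assumes u: "\<forall>i<n. \<forall>r<m. u i r = d i r - Wbar X i r - lap n m a L i r - lap n m a Z i r - Wbar p i r"
    and w: "\<forall>i<n. w i = lap n m a L i"
  shows "bip n (\<lambda>_. m) (L - (\<lambda>_. \<mu>)) u + bip n (\<lambda>_. m) (Z - zs) w
    \<le> - bip n (\<lambda>_. m) (L - (\<lambda>_. \<mu>)) (Wbar X - Wbar xs) - bip n (\<lambda>_. m) (L - (\<lambda>_. \<mu>)) (Wbar p)"
proof -
  let ?m = "\<lambda>_::nat. m" and ?M = "\<lambda>_::nat. \<mu>" and ?lap = "lap n m a"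
  have "bip n ?m (L - ?M) u =
      bip n ?m (L - ?M) (Wbar xs - Wbar X - ?lap L - ?lap (Z - zs) - Wbar p)"
    using potential by (intro bip_cong) (simp add: u lap_diff)
  then have expand: "bip n ?m (L - ?M) u = - bip n ?m (L - ?M) (Wbar X - Wbar xs)
      - bip n ?m (L - ?M) (?lap L) - bip n ?m (L - ?M) (?lap (Z - zs)) - bip n ?m (L - ?M) (Wbar p)"
    by (simp add: bip_diff_right)
  have lap_L: "?lap (L - ?M) = ?lap L"
    unfolding lap_diff lap_const by (simp add: fun_diff_def)
  have consensus: "0 \<le> bip n ?m (L - ?M) (?lap L)"
    using bip_lap_nonneg[OF graph, of m "L - ?M"] by (simp add: lap_L)
  have "bip n ?m (Z - zs) w = bip n ?m (L - ?M) (?lap (Z - zs))"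
    using bip_lap_self_adjoint[OF graph, of m "Z - zs" "L - ?M"] w
    by (simp add: lap_L bip_cong[of n ?m w "?lap L"])
  with consensus show ?thesis unfolding expand by simp
qed

lemma Fmap_dissipation:
  assumes X: "X \<in> Xset n Om" and F: "(p, u, w) \<in> Fmap n m q a Om U f W d X L Z"
  obtains g where "\<And>i. i < n \<Longrightarrow> g i \<in> subgrad (q i) (U i) (f i) (X i)"
    and "bip n q g p - (\<Sum>r<m. \<mu> r * (\<Sum>i<n. Wbar p i r)) + bip n q (X - xs) p
      + bip n (\<lambda>_. m) (L - (\<lambda>_. \<mu>)) u + bip n (\<lambda>_. m) (Z - zs) w \<le> - bip n q p p - gap X"
proof -
  let ?m = "\<lambda>_::nat. m" and ?M = "\<lambda>_::nat. \<mu>"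
  obtain g where g: "\<forall>i<n. g i \<in> subgrad (q i) (U i) (f i) (X i)"
    and p: "\<forall>i<n. \<forall>k<q i.
      p i k = proj (q i) (Om i) (\<lambda>k'. X i k' - g i k' + WTmul m (q i) (W i) (L i) k') k - X i k"
    and u: "\<forall>i<n. \<forall>r<m. u i r = d i r - Wbar X i r - lap n m a L i r - lap n m a Z i r - Wbar p i r"
    and w: "\<forall>i<n. w i = lap n m a L i"
    using F by (rule FmapE)
  have "(\<Sum>i<n. ip (q i) (g i) (p i) + ip (q i) (X i - xs i) (p i) + ip (q i) (p i) (p i)
        + (f i (X i) - f i (xs i)))
      \<le> (\<Sum>i<n. ip m (L i) (Wbar X i - Wbar xs i) + ip m (L i) (Wbar p i))"
    unfolding Wbar_def using component_in_Om[OF X] g p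
    by (intro sum_mono projection_step_inequality) auto
  then have primal: "bip n q g p + bip n q (X - xs) p + bip n q p p + (cost X - cost xs)
      \<le> bip n ?m L (Wbar X - Wbar xs) + bip n ?m L (Wbar p)"
    by (simp add: bip_def cost_def sum.distrib sum_subtractf)
  have "bip n ?m ?M (Wbar X - Wbar xs) = (\<Sum>r<m. \<mu> r * (residual X r - residual xs r))"
    by (simp add: bip_const_left residual_def sum_subtractf)
  then have "bip n ?m ?M (Wbar X - Wbar xs) = (\<Sum>r<m. \<mu> r * residual X r)"
    by (simp add: residual_xs)
  then have "bip n q g p - (\<Sum>r<m. \<mu> r * (\<Sum>i<n. Wbar p i r)) + bip n q (X - xs) p
      + bip n ?m (L - ?M) u + bip n ?m (Z - zs) w \<le> - bip n q p p - gap X"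
    using primal dual_dissipation[OF u w] unfolding gap_def bip_const_left[symmetric]
    by (simp add: bip_diff_left)
  with g show thesis by (intro that) auto
qed

end

section \<open>Solutions of the differential inclusion\<close>

locale trajectory = saddle_point +
  fixes x l z :: "real \<Rightarrow> nat \<Rightarrow> nat \<Rightarrow> real"
  assumes solution: "is_solution n m q a Om U f W d x l z" and initial: "x 0 \<in> Xset n Om"
begin

lemma x_abs_cont: "0 \<le> \<alpha> \<Longrightarrow> i < n \<Longrightarrow> k < q i \<Longrightarrow> abs_cont_on {\<alpha>..\<beta>} (\<lambda>t. x t i k)"
  and l_abs_cont: "0 \<le> \<alpha> \<Longrightarrow> i < n \<Longrightarrow> r < m \<Longrightarrow> abs_cont_on {\<alpha>..\<beta>} (\<lambda>t. l t i r)"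
  and z_abs_cont: "0 \<le> \<alpha> \<Longrightarrow> i < n \<Longrightarrow> r < m \<Longrightarrow> abs_cont_on {\<alpha>..\<beta>} (\<lambda>t. z t i r)"
  using solution unfolding is_solution_def
  by (auto intro!: abs_cont_on_subset[of "{0..max 0 \<beta>}" _ "{\<alpha>..\<beta>}"])

lemma x_Xspace: "0 \<le> t \<Longrightarrow> x t \<in> Xspace n q"
  using solution unfolding is_solution_def by blast

definition velocity ::
  "real \<Rightarrow> (nat \<Rightarrow> nat \<Rightarrow> real) \<Rightarrow> (nat \<Rightarrow> nat \<Rightarrow> real) \<Rightarrow> (nat \<Rightarrow> nat \<Rightarrow> real) \<Rightarrow> bool" where
  "velocity t p u w \<longleftrightarrow> (p, u, w) \<in> Fmap n m q a Om U f W d (x t) (l t) (z t) \<and>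
     (\<forall>i<n. (\<forall>k<q i. ((\<lambda>s. x s i k) has_real_derivative p i k) (at t)) \<and>
            (\<forall>r<m. ((\<lambda>s. l s i r) has_real_derivative u i r) (at t) \<and>
                   ((\<lambda>s. z s i r) has_real_derivative w i r) (at t)))"

lemma AE_velocity: "AE t in lebesgue. t > 0 \<longrightarrow> (\<exists>p u w. velocity t p u w)"
  using solution unfolding is_solution_def velocity_def by blast

lemma velocityD:
  assumes "velocity t p u w"
  shows "(p, u, w) \<in> Fmap n m q a Om U f W d (x t) (l t) (z t)"
    and "i < n \<Longrightarrow> k < q i \<Longrightarrow> ((\<lambda>s. x s i k) has_real_derivative p i k) (at t)"
    and "i < n \<Longrightarrow> r < m \<Longrightarrow> ((\<lambda>s. l s i r) has_real_derivative u i r) (at t)"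
    and "i < n \<Longrightarrow> r < m \<Longrightarrow> ((\<lambda>s. z s i r) has_real_derivative w i r) (at t)"
  using assms unfolding velocity_def by auto

lemma nonincreasing_along_solution:
  assumes "0 \<le> s" "s \<le> t" "abs_cont_on {s..t} h"
    and Dini: "\<And>\<tau> p u w. s < \<tau> \<Longrightarrow> \<tau> < t \<Longrightarrow> velocity \<tau> p u w \<Longrightarrow> left_Dini_le h \<tau> 0"
  shows "h t \<le> h s"
proof (rule abs_cont_on_left_Dini_nonpos_imp_le[OF assms(2,3)])
  show "AE \<tau> in lebesgue. s < \<tau> \<and> \<tau> < t \<longrightarrow> left_Dini_le h \<tau> 0"
    using AE_velocity by eventually_elim (use Dini \<open>0 \<le> s\<close> in auto)
qed

text \<open>Since \<open>x\<^sub>i + x\<^sub>i'\<close> lies in every half-space \<open>c \<cdot> v \<le> b\<close> containing \<open>\<Omega>\<^sub>i\<close>, the function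
  \<open>exp t * (c \<cdot> x\<^sub>i t - b)\<close> does not increase.\<close>

lemma halfspace_invariant:
  assumes i: "i < n" and T: "0 \<le> T" and half: "\<And>v. v \<in> Om i \<Longrightarrow> ip (q i) c v \<le> b"
  shows "ip (q i) c (x T i) \<le> b"
proof -
  define \<phi> where "\<phi> t = exp t * (ip (q i) c (x t i) - b)" for t
  have "\<phi> T \<le> \<phi> 0"
  proof (rule nonincreasing_along_solution[where h = \<phi>])
    show "abs_cont_on {0..T} \<phi>"
      unfolding \<phi>_def ip_def using i
      by (intro abs_cont_on_mult abs_cont_on_exp abs_cont_on_diff abs_cont_on_sum
          abs_cont_on_const x_abs_cont) auto
    fix t p u w assume v: "velocity t p u w"
    have "((\<lambda>t. ip (q i) c (x t i)) has_real_derivative ip (q i) c (p i)) (at t)"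
      unfolding ip_def using velocityD(2)[OF v i] by (auto intro!: DERIV_sum DERIV_cmult)
    then have "(\<phi> has_real_derivative exp t * (ip (q i) c (x t i) - b + ip (q i) c (p i))) (at t)"
      unfolding \<phi>_def by (auto intro!: derivative_eq_intros simp: algebra_simps)
    moreover have "ip (q i) c (x t i) - b + ip (q i) c (p i) \<le> 0"
    proof -
      obtain y where y: "\<And>k. k < q i \<Longrightarrow> p i k = proj (q i) (Om i) y k - x t i k"
        using velocityD(1)[OF v] i by (auto elim!: FmapE)
      have "ip (q i) c (x t i) + ip (q i) c (p i) = ip (q i) c (proj (q i) (Om i) y)"
        unfolding ip_def sum.distrib[symmetric] by (intro sum.cong) (auto simp: y algebra_simps)
      also have "\<dots> \<le> b"
        using component_in_Om[OF initial i] by (intro half proj_in_set Om_closed Om_convex i) auto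
      finally show ?thesis by simp
    qed
    ultimately show "left_Dini_le \<phi> t 0"
      by (elim has_real_derivative_imp_left_Dini_le) (simp add: mult_le_0_iff)
  qed (use T in auto)
  also have "\<phi> 0 \<le> 0" using half[OF component_in_Om[OF initial i]] by (simp add: \<phi>_def)
  finally show ?thesis by (simp add: \<phi>_def mult_le_0_iff)
qed

lemma x_Xset:
  assumes t: "0 \<le> t"
  shows "x t \<in> Xset n Om"
proof -
  have "x t i \<in> Om i" if i: "i < n" for i
  proof -
    let ?P = "proj (q i) (Om i) (x t i)"
    have nonempty: "Om i \<noteq> {}" using component_in_Om[OF initial i] by auto
    have P: "?P \<in> Om i" by (intro proj_in_set Om_closed Om_convex i nonempty)
    have "ip (q i) (x t i - ?P) (x t i) \<le> ip (q i) (x t i - ?P) ?P"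
    proof (rule halfspace_invariant[OF i t])
      fix v assume "v \<in> Om i"
      then have "ip (q i) (x t i - ?P) (v - ?P) \<le> 0"
        by (intro proj_variational Om_closed Om_convex i nonempty)
      then show "ip (q i) (x t i - ?P) v \<le> ip (q i) (x t i - ?P) ?P" by (simp add: ip_diff_right)
    qed
    then have "(nrm (q i) (x t i - ?P))\<^sup>2 \<le> 0" by (simp add: nrm_power2 ip_diff_right)
    then have "nrm (q i) (x t i - ?P) = 0" by simp
    moreover have "x t i \<in> Rn (q i)" using x_Xspace[OF t] i by (simp add: Xspace_def Xset_def)
    ultimately have "x t i = ?P" using P Om_subset_Rn[OF i] by (intro nrm_eq_0_imp_eq) auto
    then show ?thesis using P by simp
  qed
  then show ?thesis using x_Xspace[OF t] by (auto simp: Xspace_def Xset_def)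
qed

section \<open>The Lyapunov function\<close>

definition lyapunov :: "real \<Rightarrow> real" where
  "lyapunov t = gap (x t) + bip n q (x t - xs) (x t - xs) / 2
     + bip n (\<lambda>_. m) (l t - (\<lambda>_. \<mu>)) (l t - (\<lambda>_. \<mu>)) / 2
     + bip n (\<lambda>_. m) (z t - zs) (z t - zs) / 2"

lemma lyapunov_abs_cont:
  assumes "0 \<le> \<alpha>" "\<alpha> \<le> \<beta>"
  shows "abs_cont_on {\<alpha>..\<beta>} lyapunov"
proof -
  have "abs_cont_on {\<alpha>..\<beta>} (\<lambda>t. f i (x t i))" if i: "i < n" for i
    using assms component_in_U[OF x_Xset i] x_abs_cont[OF _ i]
    by (intro abs_cont_on_mix_convex_compose[OF f_convex[OF i] U_open[OF i]]) auto
  moreover have "abs_cont_on {\<alpha>..\<beta>} (\<lambda>t. residual (x t) r)" if "r < m" for r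
    unfolding residual_def Wbar_def Wmul_def using assms that
    by (auto intro!: abs_cont_on_sum abs_cont_on_cmult abs_cont_on_diff abs_cont_on_const x_abs_cont)
  ultimately have "abs_cont_on {\<alpha>..\<beta>} (\<lambda>t. gap (x t))"
    unfolding gap_def cost_def
    by (intro abs_cont_on_diff abs_cont_on_sum abs_cont_on_cmult abs_cont_on_const) auto
  moreover have halve: "abs_cont_on {\<alpha>..\<beta>} (\<lambda>t. h t / 2)" if "abs_cont_on {\<alpha>..\<beta>} h" for h
    using abs_cont_on_cmult[OF that, of "1/2"] by simp
  ultimately show ?thesis
    unfolding lyapunov_def using assms
    by (intro abs_cont_on_add halve abs_cont_on_bip_diff_self x_abs_cont l_abs_cont z_abs_cont) auto
qed

text \<open>Replacing the cost by its subgradient linearisation at \<open>t\<close> gives a differentiable \<open>G\<close> whose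
  increments towards \<open>t\<close> dominate those of the Lyapunov function.\<close>

lemma lyapunov_left_Dini:
  assumes t: "t > 0" and v: "velocity t p u w"
  shows "left_Dini_le lyapunov t (- bip n q p p - gap (x t))"
proof -
  obtain g where g: "\<And>i. i < n \<Longrightarrow> g i \<in> subgrad (q i) (U i) (f i) (x t i)"
    and dissipation: "bip n q g p - (\<Sum>r<m. \<mu> r * (\<Sum>i<n. Wbar p i r)) + bip n q (x t - xs) p
      + bip n (\<lambda>_. m) (l t - (\<lambda>_. \<mu>)) u + bip n (\<lambda>_. m) (z t - zs) w \<le> - bip n q p p - gap (x t)"
    using Fmap_dissipation[OF x_Xset velocityD(1)[OF v]] t by auto
  define G where "G s = bip n q g (x s) - (\<Sum>r<m. \<mu> r * (\<Sum>i<n. Wbar (x s) i r))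
     + bip n q (x s - xs) (x s - xs) / 2
     + bip n (\<lambda>_. m) (l s - (\<lambda>_. \<mu>)) (l s - (\<lambda>_. \<mu>)) / 2
     + bip n (\<lambda>_. m) (z s - zs) (z s - zs) / 2" for s
  have "((\<lambda>s. Wbar (x s) i r) has_real_derivative Wbar p i r) (at t)" if "i < n" "r < m" for i r
    unfolding Wbar_def Wmul_def using that velocityD(2)[OF v] by (auto intro!: DERIV_sum DERIV_cmult)
  moreover have "((\<lambda>s. bip n q g (x s)) has_real_derivative bip n q g p) (at t)"
    unfolding bip_def ip_def using velocityD(2)[OF v] by (auto intro!: DERIV_sum DERIV_cmult)
  ultimately have "(G has_real_derivative (bip n q g p - (\<Sum>r<m. \<mu> r * (\<Sum>i<n. Wbar p i r))
      + bip n q (x t - xs) p + bip n (\<lambda>_. m) (l t - (\<lambda>_. \<mu>)) u + bip n (\<lambda>_. m) (z t - zs) w)) (at t)"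
    unfolding G_def using velocityD(2-4)[OF v]
    by (intro DERIV_add DERIV_diff has_real_derivative_bip_diff_self DERIV_sum DERIV_cmult) auto
  from this dissipation have "left_Dini_le G t (- bip n q p p - gap (x t))"
    by (rule has_real_derivative_imp_left_Dini_le)
  moreover have "lyapunov t - lyapunov s \<le> G t - G s" if s: "s > 0" for s
  proof -
    have "cost (x t) + (bip n q g (x s) - bip n q g (x t)) \<le> cost (x s)"
      using s by (intro cost_subgradient g x_Xset) auto
    moreover have "(\<Sum>r<m. \<mu> r * residual (x t) r) - (\<Sum>r<m. \<mu> r * residual (x s) r) =
        (\<Sum>r<m. \<mu> r * (\<Sum>i<n. Wbar (x t) i r)) - (\<Sum>r<m. \<mu> r * (\<Sum>i<n. Wbar (x s) i r))"
      by (simp add: residual_def right_diff_distrib sum_subtractf)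
    ultimately show ?thesis unfolding lyapunov_def G_def gap_def by linarith
  qed
  then have "\<forall>\<^sub>F s in at_left t. lyapunov t - lyapunov s \<le> G t - G s"
    using t by (intro eventually_at_leftI[of 0]) auto
  ultimately show ?thesis by (rule left_Dini_le_dominated)
qed

lemma lyapunov_dissipation:
  assumes st: "0 \<le> s" "s \<le> t" and R: "abs_cont_on {s..t} R"
    and Dini: "\<And>\<tau> p u w. s < \<tau> \<Longrightarrow> \<tau> < t \<Longrightarrow> velocity \<tau> p u w \<Longrightarrow>
      left_Dini_le R \<tau> (bip n q p p + gap (x \<tau>))"
  shows "lyapunov t + R t \<le> lyapunov s + R s"
proof (rule nonincreasing_along_solution[OF st])
  show "abs_cont_on {s..t} (\<lambda>\<tau>. lyapunov \<tau> + R \<tau>)"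
    by (intro abs_cont_on_add lyapunov_abs_cont R st)
  fix \<tau> p u w assume \<tau>: "s < \<tau>" "\<tau> < t" and v: "velocity \<tau> p u w"
  show "left_Dini_le (\<lambda>\<tau>. lyapunov \<tau> + R \<tau>) \<tau> 0"
    using left_Dini_le_add[OF lyapunov_left_Dini[OF _ v] Dini[OF \<tau> v]] \<tau> st by simp
qed

lemma lyapunov_decrease:
  assumes "0 \<le> s" "s \<le> t" and gap: "\<And>\<tau>. s < \<tau> \<Longrightarrow> \<tau> < t \<Longrightarrow> c \<le> gap (x \<tau>)"
  shows "lyapunov t + c * (t - s) \<le> lyapunov s"
proof -
  have "lyapunov t + c * t \<le> lyapunov s + c * s"
  proof (rule lyapunov_dissipation[OF assms(1,2)])
    show "abs_cont_on {s..t} (\<lambda>\<tau>. c * \<tau>)"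
      by (intro abs_cont_on_cmult abs_cont_on_ident)
    fix \<tau> p u w assume "s < \<tau>" "\<tau> < t"
    then have "c * 1 \<le> bip n q p p + gap (x \<tau>)"
      using add_mono[OF bip_self_nonneg gap] by simp
    then show "left_Dini_le (\<lambda>\<tau>. c * \<tau>) \<tau> (bip n q p p + gap (x \<tau>))"
      by (rule has_real_derivative_imp_left_Dini_le[OF DERIV_cmult[OF DERIV_ident]])
  qed
  then show ?thesis by (simp add: algebra_simps)
qed

lemma lyapunov_antimono:
  assumes "0 \<le> s" "s \<le> t"
  shows "lyapunov t \<le> lyapunov s"
  using lyapunov_decrease[OF assms, of 0] gap_nonneg[OF x_Xset] assms(1) by simp

lemma lyapunov_bounds:
  assumes t: "0 \<le> t"
  shows "0 \<le> lyapunov t"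
    and "i < n \<Longrightarrow> k < q i \<Longrightarrow> (x t i k - xs i k)\<^sup>2 \<le> 2 * lyapunov t"
    and "i < n \<Longrightarrow> r < m \<Longrightarrow> (l t i r - \<mu> r)\<^sup>2 \<le> 2 * lyapunov t"
    and "i < n \<Longrightarrow> r < m \<Longrightarrow> (z t i r - zs i r)\<^sup>2 \<le> 2 * lyapunov t"
proof -
  let ?x = "x t - xs" and ?l = "l t - (\<lambda>_. \<mu>)" and ?z = "z t - zs"
  have nonneg: "0 \<le> gap (x t)" "0 \<le> bip n q ?x ?x" "0 \<le> bip n (\<lambda>_. m) ?l ?l" "0 \<le> bip n (\<lambda>_. m) ?z ?z"
    by (intro gap_nonneg x_Xset t bip_self_nonneg)+
  then show "0 \<le> lyapunov t" by (simp add: lyapunov_def)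
  show "(x t i k - xs i k)\<^sup>2 \<le> 2 * lyapunov t" if "i < n" "k < q i"
    using coordinate_power2_le_bip[where K = q and u = ?x, OF that] nonneg by (simp add: lyapunov_def)
  show "(l t i r - \<mu> r)\<^sup>2 \<le> 2 * lyapunov t" if "i < n" "r < m"
    using coordinate_power2_le_bip[where K = "\<lambda>_. m" and u = ?l, OF that] nonneg
    by (simp add: lyapunov_def)
  show "(z t i r - zs i r)\<^sup>2 \<le> 2 * lyapunov t" if "i < n" "r < m"
    using coordinate_power2_le_bip[where K = "\<lambda>_. m" and u = ?z, OF that] nonneg
    by (simp add: lyapunov_def)
qed

section \<open>Boundedness and convergence\<close>

theorem solution_bounded:
  "\<exists>B. \<forall>t\<ge>0. \<forall>i<n. (\<forall>k<q i. \<bar>x t i k\<bar> \<le> B) \<and> (\<forall>r<m. \<bar>l t i r\<bar> \<le> B \<and> \<bar>z t i r\<bar> \<le> B)"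
proof -
  define A where "A = (\<lambda>(i, k). \<bar>xs i k\<bar>) ` Sigma {..<n} (\<lambda>i. {..<q i}) \<union> (\<lambda>r. \<bar>\<mu> r\<bar>) ` {..<m} \<union>
    (\<lambda>(i, r). \<bar>zs i r\<bar>) ` ({..<n} \<times> {..<m})"
  define B where "B = sqrt (2 * lyapunov 0) + Max (insert 0 A)"
  have "finite A" by (simp add: A_def)
  then have centre: "\<bar>c\<bar> \<le> Max (insert 0 A)" if "\<bar>c\<bar> \<in> A" for c using that by simp
  have bound: "\<bar>y\<bar> \<le> B" if "(y - c)\<^sup>2 \<le> 2 * lyapunov t" "0 \<le> t" "\<bar>c\<bar> \<in> A" for y c t
  proof -
    have "(y - c)\<^sup>2 \<le> 2 * lyapunov 0" using that lyapunov_antimono[of 0 t] by simp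
    then have "\<bar>y - c\<bar> \<le> sqrt (2 * lyapunov 0)" by (metis real_sqrt_abs real_sqrt_le_iff)
    then show ?thesis using centre[OF that(3)] by (simp add: B_def)
  qed
  have "\<bar>x t i k\<bar> \<le> B" if "0 \<le> t" "i < n" "k < q i" for t i k
    using that by (intro bound[OF lyapunov_bounds(2)]) (force simp: A_def)+
  moreover have "\<bar>l t i r\<bar> \<le> B" if "0 \<le> t" "i < n" "r < m" for t i r
    using that by (intro bound[OF lyapunov_bounds(3)]) (force simp: A_def)+
  moreover have "\<bar>z t i r\<bar> \<le> B" if "0 \<le> t" "i < n" "r < m" for t i r
    using that by (intro bound[OF lyapunov_bounds(4)]) (force simp: A_def)+
  ultimately show ?thesis by blast
qed

lemma x_increment_le:
  assumes st: "0 \<le> s" "s \<le> t" and ik: "i < n" "k < q i"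
  shows "\<bar>x t i k - x s i k\<bar> \<le> lyapunov s - lyapunov t + (t - s) / 4"
proof -
  have "lyapunov t + (\<sigma> * x t i k - 1/4 * t) \<le> lyapunov s + (\<sigma> * x s i k - 1/4 * s)"
    if \<sigma>: "\<sigma>\<^sup>2 = 1" for \<sigma> :: real
  proof (rule lyapunov_dissipation[OF st])
    show "abs_cont_on {s..t} (\<lambda>t. \<sigma> * x t i k - 1/4 * t)"
      by (intro abs_cont_on_diff abs_cont_on_cmult abs_cont_on_ident x_abs_cont ik st)
    fix \<tau> p u w assume \<tau>: "s < \<tau>" and v: "velocity \<tau> p u w"
    have "0 \<le> (\<sigma> * p i k - 1/2)\<^sup>2" by simp
    also have "\<dots> = (p i k)\<^sup>2 - (\<sigma> * p i k - 1/4 * 1)"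
      by (simp add: power2_diff power_mult_distrib \<sigma> power2_eq_square[of "1/2"])
    finally have "\<sigma> * p i k - 1/4 * 1 \<le> (p i k)\<^sup>2" by simp
    also have "\<dots> \<le> bip n q p p" using ik by (rule coordinate_power2_le_bip)
    also have "\<dots> \<le> bip n q p p + gap (x \<tau>)" using gap_nonneg[OF x_Xset] \<tau> st by simp
    finally show "left_Dini_le (\<lambda>t. \<sigma> * x t i k - 1/4 * t) \<tau> (bip n q p p + gap (x \<tau>))"
      by (rule has_real_derivative_imp_left_Dini_le[rotated])
         (intro DERIV_diff DERIV_cmult DERIV_ident velocityD(2)[OF v] ik)
  qed
  from this[of 1, simplified] this[of "-1", simplified] show ?thesis
    unfolding diff_divide_distrib by linarith
qed

text \<open>A visit of \<open>x\<close> at distance \<open>\<epsilon>\<close> from the optimum lasts long enough to consume \<open>c * \<epsilon>\<close> of the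
  Lyapunov function, which is impossible once it is that close to its infimum.\<close>

theorem x_tendsto:
  assumes ik: "i < n" "k < q i"
  shows "((\<lambda>t. x t i k) \<longlongrightarrow> xs i k) at_top"
proof (rule tendstoI)
  fix \<epsilon> :: real assume \<epsilon>: "\<epsilon> > 0"
  obtain B where bounded: "\<And>t. t \<ge> 0 \<Longrightarrow> \<forall>i<n. \<forall>k<q i. \<bar>x t i k\<bar> \<le> B"
    using solution_bounded by blast
  obtain c where "c > 0" and gap_ge: "\<And>y. y \<in> Xset n Om \<Longrightarrow> \<forall>i<n. \<forall>k<q i. \<bar>y i k\<bar> \<le> B \<Longrightarrow>
      \<epsilon> / 2 \<le> \<bar>y i k - xs i k\<bar> \<Longrightarrow> c \<le> gap y"
    using gap_bounded_below[of "\<epsilon> / 2" B i k] \<epsilon> by auto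
  define V0 where "V0 = Inf (lyapunov ` {0..})"
  have V0: "V0 \<le> lyapunov t" if "0 \<le> t" for t
    unfolding V0_def using that lyapunov_bounds(1) by (intro cInf_lower bdd_belowI[of _ 0]) auto
  have "V0 < V0 + min (\<epsilon> / 4) (c * \<epsilon>)" using \<epsilon> \<open>c > 0\<close> by simp
  then obtain T where T: "0 \<le> T" "lyapunov T < V0 + min (\<epsilon> / 4) (c * \<epsilon>)"
    using cInf_lessD[of "lyapunov ` {0..}" "V0 + min (\<epsilon> / 4) (c * \<epsilon>)"] unfolding V0_def by auto
  have "dist (x t i k) (xs i k) < \<epsilon>" if "T \<le> t" for t
  proof (rule ccontr)
    assume "\<not> ?thesis"
    then have far: "\<epsilon> \<le> \<bar>x t i k - xs i k\<bar>" by (simp add: dist_real_def)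
    have t: "0 \<le> t" "lyapunov t < V0 + \<epsilon> / 4" "lyapunov t < V0 + c * \<epsilon>"
      using T that lyapunov_antimono[OF T(1) that] by auto
    have gap_ge_on_visit: "c \<le> gap (x s)" if s: "t \<le> s" "s \<le> t + \<epsilon>" for s
    proof -
      have "\<bar>x s i k - x t i k\<bar> \<le> lyapunov t - lyapunov s + (s - t) / 4"
        by (rule x_increment_le[OF t(1) s(1) ik])
      also have "\<dots> \<le> \<epsilon> / 4 + \<epsilon> / 4" using t V0[of s] s by (intro add_mono) auto
      finally have "\<epsilon> / 2 \<le> \<bar>x s i k - xs i k\<bar>" using far by linarith
      then show ?thesis using s t(1) by (intro gap_ge x_Xset bounded) auto
    qed
    have "lyapunov (t + \<epsilon>) + c * (t + \<epsilon> - t) \<le> lyapunov t"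
      using t(1) \<epsilon> gap_ge_on_visit by (intro lyapunov_decrease) auto
    then show False using t V0[of "t + \<epsilon>"] \<epsilon> by (simp add: algebra_simps)
  qed
  then show "\<forall>\<^sub>F t in at_top. dist (x t i k) (xs i k) < \<epsilon>"
    unfolding eventually_at_top_linorder by blast
qed

end

lemma (in resource_allocation) trajectory_exists:
  assumes sol: "is_solution n m q a Om U f W d x l z" "x 0 \<in> Xset n Om"
    and opt: "is_optimal n m q Om f W d xs"
  obtains \<mu> zs where "trajectory n m q a Om U f W d xs \<mu> zs x l z"
proof -
  have feasible: "feasible n m q Om W d xs" using opt by (simp add: is_optimal_def)
  obtain \<mu> where \<mu>: "\<forall>y\<in>Xset n Om. (\<Sum>r<m. \<mu> r * residual y r) \<le> cost y - cost xs"
    using Lagrange_multiplier_exists[OF opt] by blast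
  obtain zs where zs: "\<forall>i<n. \<forall>r<m. lap n m a zs i r = d i r - Wbar xs i r"
    using residual_potential_exists[OF feasible] by blast
  show thesis
    by (rule that[of \<mu> zs]) (unfold_locales, use feasible \<mu> zs sol in auto)
qed

theorem theorem4:
  fixes n m :: nat and q :: "nat \<Rightarrow> nat" and a :: "nat \<Rightarrow> nat \<Rightarrow> real"
    and Om U :: "nat \<Rightarrow> (nat \<Rightarrow> real) set" and f :: "nat \<Rightarrow> (nat \<Rightarrow> real) \<Rightarrow> real"
    and W :: "nat \<Rightarrow> nat \<Rightarrow> nat \<Rightarrow> real" and d :: "nat \<Rightarrow> nat \<Rightarrow> real"
  assumes n_pos: "n \<ge> 1"
    and graph: "weighted_graph n a" and conn: "graph_connected n a"
    and Om_closed: "\<forall>i<n. closed_Rn (q i) (Om i)"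
    and Om_convex: "\<forall>i<n. cvx_set (Om i)"
    and U_open: "\<forall>i<n. open_Rn (q i) (U i) \<and> Om i \<subseteq> U i"
    and f_strict: "\<forall>i<n. strict_cvx_on (q i) (U i) (f i)"
    and d_dim: "\<forall>i<n. d i \<in> Rn m"
    and slater: "\<exists>x. (\<forall>i<n. x i \<in> interior_Rn (q i) (Om i)) \<and> (\<forall>i\<ge>n. x i = (\<lambda>_. 0)) \<and>
                   (\<forall>r<m. (\<Sum>i<n. Wmul m (q i) (W i) (x i) r) = (\<Sum>i<n. d i r))"
    and opt_exists: "\<exists>xs. is_optimal n m q Om f W d xs"
    and F_convex: "\<forall>x\<in>Xset n Om. \<forall>l\<in>Lspace n m. \<forall>z\<in>Lspace n m.
                     cvx_set3 (Fmap n m q a Om U f W d x l z)"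
  shows
    "\<forall>x l z. is_solution n m q a Om U f W d x l z \<and> x 0 \<in> Xset n Om \<longrightarrow>
       (\<exists>B. \<forall>t\<ge>0. \<forall>i<n. (\<forall>k<q i. \<bar>x t i k\<bar> \<le> B) \<and> (\<forall>r<m. \<bar>l t i r\<bar> \<le> B \<and> \<bar>z t i r\<bar> \<le> B)) \<and>
       (\<forall>xs. is_optimal n m q Om f W d xs \<longrightarrow>
          (\<forall>i<n. \<forall>k<q i. ((\<lambda>t. x t i k) \<longlongrightarrow> xs i k) at_top))"
proof (intro allI impI, elim conjE)
  fix x l z assume solution: "is_solution n m q a Om U f W d x l z" "x 0 \<in> Xset n Om"
  interpret resource_allocation n m q a Om U f W d
    using assms by unfold_locales auto
  note trajectory = trajectory_exists[OF solution]
  have "\<exists>B. \<forall>t\<ge>0. \<forall>i<n. (\<forall>k<q i. \<bar>x t i k\<bar> \<le> B) \<and> (\<forall>r<m. \<bar>l t i r\<bar> \<le> B \<and> \<bar>z t i r\<bar> \<le> B)"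
    using opt_exists trajectory trajectory.solution_bounded by metis
  moreover have "((\<lambda>t. x t i k) \<longlongrightarrow> xs i k) at_top"
    if "is_optimal n m q Om f W d xs" "i < n" "k < q i" for xs i k
    using trajectory[OF that(1)] trajectory.x_tendsto that(2,3) by metis
  ultimately show "(\<exists>B. \<forall>t\<ge>0. \<forall>i<n. (\<forall>k<q i. \<bar>x t i k\<bar> \<le> B) \<and> (\<forall>r<m. \<bar>l t i r\<bar> \<le> B \<and> \<bar>z t i r\<bar> \<le> B)) \<and>
       (\<forall>xs. is_optimal n m q Om f W d xs \<longrightarrow>
          (\<forall>i<n. \<forall>k<q i. ((\<lambda>t. x t i k) \<longlongrightarrow> xs i k) at_top))"
    by blast
qed

end
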